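(* Consider an IMEX-MRI-SR method with $s^{\{S\}}$ slow stages, coefficient matrices $\Omega^{\{0\}},\dots,\Omega^{\{n_\Omega-1\}},\Gamma$ and abscissae $c^{\{S\}}$, whose fast subproblems are each solved by one step of a Runge--Kutta method $(A^{\{F\}},b^{\{F\}},c^{\{F\}})$. Write $e:=e_{s^{\{S\}}}\in\mathbb{R}^{s^{\{S\}}}$ for the last standard basis vector, $C^{\{S\}}:=\operatorname{diag}(c^{\{S\}})$, $\overline{\Omega}:=\sum_{k=0}^{n_\Omega-1}\frac{1}{k+1}\Omega^{\{k\}}$ and $M:=\sum_{k=0}^{n_\Omega-1}\frac{1}{(k+1)(k+2)}\Omega^{\{k\}}$. Suppose that the method is internally consistent, that its slow base method is fourth-order accurate, that the fast Runge--Kutta method is accurate of order $\max(4,n_\Omega+2)$, and that the third-order coupling condition $e^TMc^{\{S\}}=\frac16$ holds. If moreover $$e^T\left(\sum_{k=0}^{n_\Omega-1}\frac{1}{(k+1)(k+3)}\,\Omega^{\{k\}}\right)c^{\{S\}}=\frac18,$$ $$e^TM\,C^{\{S\}}c^{\{S\}}=\frac1{12},$$ $$e^T\Gamma\, C^{\{S\}}M c^{\{S\}}=0,$$ $$e^T\overline{\Omega}\, C^{\{S\}}M c^{\{S\}}=\frac1{24},$$ $$e^TM\,\overline{\Omega}\,c^{\{S\}}=\frac1{24},$$ $$e^TM\,\Gamma\, c^{\{S\}}=0,$$ then the IMEX-MRI-SR method is fourth-order accurate.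
   Context: The problem class is $y'(t)=f^{\{F\}}(t,y)+f^{\{I\}}(t,y)+f^{\{E\}}(t,y)$, $y(t_0)=y_0$, with $y(t)\in\mathbb{R}^d$ ($d$ arbitrary) and sufficiently smooth right-hand sides. An IMEX-MRI-SR (implicit-explicit multirate infinitesimal stage-restart) method is given by strictly lower-triangular real $s^{\{S\}}\times s^{\{S\}}$ matrices $\Omega^{\{k\}}=(\omega^{\{k\}}_{i,j})$, $k=0,\dots,n_\Omega-1$ ($n_\Omega\ge 1$), a lower-triangular real $s^{\{S\}}\times s^{\{S\}}$ matrix $\Gamma=(\gamma_{i,j})$ whose first row is zero, and $c^{\{S\}}\in\mathbb{R}^{s^{\{S\}}}$ with $c^{\{S\}}_1=0$ and $c^{\{S\}}_i\neq0$ for $i\ge2$. Put $\omega_{i,j}(\tau)=\sum_{k=0}^{n_\Omega-1}\omega^{\{k\}}_{i,j}\tau^k$. One step from $t_n$ to $t_n+H$ is: $Y_1^{\{S\}}=y_n$; for $i=2,\dots,s^{\{S\}}$, solve from $\theta=0$ to $\theta=c^{\{S\}}_iH$ $$v_i'(\theta)=f^{\{F\}}(t_n+\theta,v_i(\theta))+\frac{1}{c^{\{S\}}_i}\sum_{j=1}^{i-1}\omega_{i,j}\!\left(\frac{\theta}{c^{\{S\}}_iH}\right)\left(f^{\{E\}}_j+f^{\{I\}}_j\right),\qquad v_i(0)=y_n,$$ and then solve $Y^{\{S\}}_i=v_i(c^{\{S\}}_iH)+H\sum_{j=1}^{i}\gamma_{i,j}f^{\{I\}}_j$; finally $y_{n+1}=Y^{\{S\}}_{s^{\{S\}}}$.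 Here $f^{\{\sigma\}}_j=f^{\{\sigma\}}(t_n+c^{\{S\}}_jH,Y^{\{S\}}_j)$ for $\sigma\in\{E,I\}$. Fast solver: each fast initial-value problem is solved by a single step (of size $c_i^{\{S\}}H$) of the Runge--Kutta method $(A^{\{F\}},b^{\{F\}},c^{\{F\}})$ with $s^{\{F\}}$ stages and $c^{\{F\}}=A^{\{F\}}\mathbb{1}$. That is, with fast stages $$V_{i,j}=y_n+c^{\{S\}}_iH\sum_{k}a^{\{F\}}_{j,k}f^{\{F\}}_{i,k}+H\sum_{k}a^{\{F\}}_{j,k}\sum_{\ell=1}^{i-1}\omega_{i,\ell}(c^{\{F\}}_k)\left(f^{\{E\}}_\ell+f^{\{I\}}_\ell\right),$$ $f^{\{F\}}_{i,k}=f^{\{F\}}(t_n+c^{\{S\}}_ic^{\{F\}}_kH,V_{i,k})$, the value $v_i(c_i^{\{S\}}H)$ is $y_n+c^{\{S\}}_iH\sum_j b^{\{F\}}_jf^{\{F\}}_{i,j}+H\sum_j b^{\{F\}}_j\sum_{\ell=1}^{i-1}\omega_{i,\ell}(c^{\{F\}}_j)(f^{\{E\}}_\ell+f^{\{I\}}_\ell)$. GARK form: with $\otimes$ the Kronecker product and $c^{\{F\}\times k}$ the element-wise $k$-th power, $\mathbf{A}^{\{F,F\}}=C^{\{S\}}\otimes A^{\{F\}}$, $\mathbf{A}^{\{F,E\}}=\mathbf{A}^{\{F,I\}}=\sum_{k=0}^{n_\Omega-1}\Omega^{\{k\}}\otimes(A^{\{F\}}c^{\{F\}\times k})$, $\mathbf{A}^{\{S,F\}}=C^{\{S\}}\otimes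 b^{\{F\},T}$, $\mathbf{A}^{\{S,E\}}=\overline{\Omega}$, $\mathbf{A}^{\{S,I\}}=\overline{\Omega}+\Gamma$, and $\mathbf{b}^{\{\nu\},T}=e_{s^{\{S\}}}^T\mathbf{A}^{\{S,\nu\}}$ for $\nu\in\{F,E,I\}$. With $\mathbf{c}^{\{\sigma,\nu\}}$ the vector of row sums of $\mathbf{A}^{\{\sigma,\nu\}}$, the method is internally consistent if $\mathbf{c}^{\{F,F\}}=\mathbf{c}^{\{F,E\}}=\mathbf{c}^{\{F,I\}}$ and $\mathbf{c}^{\{S,F\}}=\mathbf{c}^{\{S,E\}}=\mathbf{c}^{\{S,I\}}$ (the latter common vector being $c^{\{S\}}$). The slow base method is the additive Runge--Kutta (ARK) method for $y'=f^{\{E\}}+f^{\{I\}}$ (obtained when $f^{\{F\}}=0$) with explicit tableau $A^{\{E\}}=\overline{\Omega}$, $b^{\{E\},T}=e_{s^{\{S\}}}^T\overline{\Omega}$, $c^{\{E\}}=\overline{\Omega}\mathbb{1}$ and implicit tableau $A^{\{I\}}=\overline{\Omega}+\Gamma$, $b^{\{I\},T}=e_{s^{\{S\}}}^T(\overline{\Omega}+\Gamma)$, $c^{\{I\}}=(\overline{\Omega}+\Gamma)\mathbb{1}$; its order is that of an ARK method (including the coupling conditions between the two tableaux). A method is accurate of order $p$ if for all sufficiently smooth right-hand sides its one-step local error starting from exact data is $O(H^{p+1})$ as $H\to0$, equivalently (for Runge--Kutta, ARK and GARK methods as here) if all algebraic order conditions through order $p$ hold. *)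

theory Defs
  imports "HOL-Analysis.Analysis" "HOL-Library.Landau_Symbols"
begin

section \<open>Right-hand sides on \<open>\<real>\<^sup>d\<close> with \<open>d\<close> a term-level parameter\<close>

text \<open>
  The order of a method refers to all dimensions \<open>d\<close> at once, so \<open>d\<close> cannot be a type.
  A point of \<open>\<real>\<^sup>d\<close> is a function on the naturals of which only the coordinates
  \<open>0, \<dots>, d - 1\<close> matter: functions of the state may not look at the other coordinates,
  and equations between states are only required for the coordinates below \<open>d\<close>.
\<close>

type_synonym state = "nat \<Rightarrow> real"
type_synonym rhs = "real \<Rightarrow> state \<Rightarrow> state"

definition depends_only :: "nat \<Rightarrow> (real \<Rightarrow> state \<Rightarrow> real) \<Rightarrow> bool" where
  "depends_only d g \<longleftrightarrow> (\<forall>t x x'. (\<forall>\<kappa><d. x \<kappa> = x' \<kappa>) \<longrightarrow> g t x = g t x')"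

text \<open>
  All partial derivatives of order at most \<open>m\<close>, in \<open>t\<close> and in the first \<open>d\<close> coordinates, exist
  and are jointly continuous. The product topology on \<^typ>\<open>state\<close> induces the usual
  topology on the first \<open>d\<close> coordinates.
\<close>

primrec Ck :: "nat \<Rightarrow> nat \<Rightarrow> (real \<Rightarrow> state \<Rightarrow> real) \<Rightarrow> bool" where
  "Ck d 0 g \<longleftrightarrow> continuous_on UNIV (\<lambda>(t, x). g t x)"
| "Ck d (Suc m) g \<longleftrightarrow>
     continuous_on UNIV (\<lambda>(t, x). g t x) \<and>
     (\<exists>h. (\<forall>t x. ((\<lambda>s. g s x) has_real_derivative h t x) (at t)) \<and> Ck d m h) \<and>
     (\<forall>\<kappa><d. \<exists>h. (\<forall>t x. ((\<lambda>s. g t (x(\<kappa> := s))) has_real_derivative h t x) (at (x \<kappa>)))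
                 \<and> Ck d m h)"

definition smooth_rhs :: "nat \<Rightarrow> nat \<Rightarrow> rhs \<Rightarrow> bool" where
  "smooth_rhs d m f \<longleftrightarrow>
     (\<forall>\<kappa><d. depends_only d (\<lambda>t x. f t x \<kappa>) \<and> Ck d m (\<lambda>t x. f t x \<kappa>))"


section \<open>Order of accuracy of a one-step method\<close>

datatype part = Fast | Impl | Expl

text \<open>
  \<open>y' = (\<Sum>\<sigma>\<in>P. f \<sigma> t y)\<close> on \<open>[t0, t0 + T]\<close>. The set \<open>P\<close> of parts is
  \<open>{Fast}\<close> for a Runge--Kutta method, \<open>{Expl, Impl}\<close> for an ARK method
  and \<open>UNIV\<close> for an IMEX-MRI-SR method.
\<close>

definition exact_solution ::
  "nat \<Rightarrow> part set \<Rightarrow> (part \<Rightarrow> rhs) \<Rightarrow> real \<Rightarrow> real \<Rightarrow> (real \<Rightarrow> state) \<Rightarrow> bool" where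
  "exact_solution d P f t0 T y \<longleftrightarrow>
     (\<forall>t\<in>{t0..t0 + T}. \<forall>\<kappa><d.
        ((\<lambda>t. y t \<kappa>) has_real_derivative (\<Sum>\<sigma>\<in>P. f \<sigma> t (y t) \<kappa>)) (at t within {t0..t0 + T}))"

text \<open>
  A method is given by the relation \<open>step d f t0 y0 H Y z\<close>: the values \<open>Y\<close>, indexed by the set
  \<open>St\<close>, solve the stage equations of the step from \<open>(t0, y0)\<close> with step size \<open>H\<close>, and \<open>z\<close> is
  the resulting approximation at \<open>t0 + H\<close>.
\<close>

type_synonym 's step_rel =
  "nat \<Rightarrow> (part \<Rightarrow> rhs) \<Rightarrow> real \<Rightarrow> state \<Rightarrow> real \<Rightarrow> ('s \<Rightarrow> state) \<Rightarrow> state \<Rightarrow> bool"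

text \<open>
  Order \<open>p\<close>: for all sufficiently smooth (\<open>C\<^sup>m\<close> for some \<open>m\<close>
  depending only on the method) parts \<open>f \<sigma>\<close> in every dimension,
  the error after one step from exact data is \<open>O(H\<^sup>p\<^sup>+\<^sup>1)\<close> as \<open>H\<close> tends to \<open>0\<close>
  from the right. Nonlinear implicit stage equations may have several solutions; as usual, the
  step is the one whose stages tend to \<open>y0\<close> with \<open>H\<close>. For \<open>C\<^sup>1\<close> right-hand sides the implicit
  function theorem gives exactly one such solution for small \<open>H\<close>, whatever the tableau, so
  solvability is not a condition on the method.
\<close>

definition accurate :: "nat \<Rightarrow> part set \<Rightarrow> 's set \<Rightarrow> 's step_rel \<Rightarrow> bool" where
  "accurate p P St step \<longleftrightarrow>
     (\<exists>m. \<forall>d f t0 T y Y z.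
        (\<forall>\<sigma>\<in>P. smooth_rhs d m (f \<sigma>)) \<longrightarrow>
        T > 0 \<longrightarrow>
        exact_solution d P f t0 T y \<longrightarrow>
        (\<forall>\<^sub>F H in at_right 0. step d f t0 (y t0) H (Y H) (z H)) \<longrightarrow>
        (\<forall>r\<in>St. \<forall>\<kappa><d. ((\<lambda>H. Y H r \<kappa>) \<longlongrightarrow> y t0 \<kappa>) (at_right 0)) \<longrightarrow>
        (\<forall>\<kappa><d. (\<lambda>H. z H \<kappa> - y (t0 + H) \<kappa>) \<in> O[at_right 0](\<lambda>H. H ^ (p + 1))))"


section \<open>Vectors and matrices indexed from 1\<close>

type_synonym mtx = "nat \<Rightarrow> nat \<Rightarrow> real"

definition mv :: "nat \<Rightarrow> mtx \<Rightarrow> (nat \<Rightarrow> real) \<Rightarrow> (nat \<Rightarrow> real)" where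
  "mv n A x = (\<lambda>i. \<Sum>j=1..n. A i j * x j)"

definition dot :: "nat \<Rightarrow> (nat \<Rightarrow> real) \<Rightarrow> (nat \<Rightarrow> real) \<Rightarrow> real" where
  "dot n x y = (\<Sum>i=1..n. x i * y i)"

definition unitvec :: "nat \<Rightarrow> nat \<Rightarrow> real" where
  "unitvec i = (\<lambda>j. if j = i then 1 else 0)"

definition diag :: "(nat \<Rightarrow> real) \<Rightarrow> mtx" where
  "diag c = (\<lambda>i j. if i = j then c i else 0)"

definition madd :: "mtx \<Rightarrow> mtx \<Rightarrow> mtx" where
  "madd A B = (\<lambda>i j. A i j + B i j)"

definition rowsum :: "nat \<Rightarrow> mtx \<Rightarrow> (nat \<Rightarrow> real)" where
  "rowsum n A = (\<lambda>i. \<Sum>j=1..n. A i j)"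

definition lincomb :: "nat \<Rightarrow> (nat \<Rightarrow> real) \<Rightarrow> (nat \<Rightarrow> mtx) \<Rightarrow> mtx" where
  "lincomb n w \<Omega> = (\<lambda>i j. \<Sum>k<n. w k * \<Omega> k i j)"

definition Omega_bar :: "nat \<Rightarrow> (nat \<Rightarrow> mtx) \<Rightarrow> mtx" where
  "Omega_bar n \<Omega> = lincomb n (\<lambda>k. 1 / (real k + 1)) \<Omega>"

definition M_mat :: "nat \<Rightarrow> (nat \<Rightarrow> mtx) \<Rightarrow> mtx" where
  "M_mat n \<Omega> = lincomb n (\<lambda>k. 1 / ((real k + 1) * (real k + 2))) \<Omega>"


section \<open>Runge--Kutta and additive Runge--Kutta methods\<close>

definition rk_step :: "nat \<Rightarrow> mtx \<Rightarrow> (nat \<Rightarrow> real) \<Rightarrow> (nat \<Rightarrow> real) \<Rightarrow> nat step_rel" where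
  "rk_step s A b c d f t0 y0 H Y z \<longleftrightarrow>
     (\<forall>i\<in>{1..s}. \<forall>\<kappa><d.
        Y i \<kappa> = y0 \<kappa> + H * (\<Sum>j=1..s. A i j * f Fast (t0 + c j * H) (Y j) \<kappa>)) \<and>
     (\<forall>\<kappa><d. z \<kappa> = y0 \<kappa> + H * (\<Sum>j=1..s. b j * f Fast (t0 + c j * H) (Y j) \<kappa>))"

definition rk_accurate ::
  "nat \<Rightarrow> nat \<Rightarrow> mtx \<Rightarrow> (nat \<Rightarrow> real) \<Rightarrow> (nat \<Rightarrow> real) \<Rightarrow> bool" where
  "rk_accurate p s A b c \<longleftrightarrow> accurate p {Fast} {1..s} (rk_step s A b c)"

definition ark_step ::
  "nat \<Rightarrow> mtx \<Rightarrow> (nat \<Rightarrow> real) \<Rightarrow> (nat \<Rightarrow> real) \<Rightarrow> mtx \<Rightarrow> (nat \<Rightarrow> real) \<Rightarrow> (nat \<Rightarrow> real) \<Rightarrow>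
   nat step_rel" where
  "ark_step s Aex bex cex Aim bim cim d f t0 y0 H Y z \<longleftrightarrow>
     (\<forall>i\<in>{1..s}. \<forall>\<kappa><d.
        Y i \<kappa> = y0 \<kappa>
          + H * (\<Sum>j=1..s. Aex i j * f Expl (t0 + cex j * H) (Y j) \<kappa>)
          + H * (\<Sum>j=1..s. Aim i j * f Impl (t0 + cim j * H) (Y j) \<kappa>)) \<and>
     (\<forall>\<kappa><d. z \<kappa> = y0 \<kappa>
          + H * (\<Sum>j=1..s. bex j * f Expl (t0 + cex j * H) (Y j) \<kappa>)
          + H * (\<Sum>j=1..s. bim j * f Impl (t0 + cim j * H) (Y j) \<kappa>))"

definition slow_base_accurate :: "nat \<Rightarrow> nat \<Rightarrow> nat \<Rightarrow> (nat \<Rightarrow> mtx) \<Rightarrow> mtx \<Rightarrow> bool" where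
  "slow_base_accurate p s n \<Omega> \<Gamma> \<longleftrightarrow>
     (let Aex = Omega_bar n \<Omega>; Aim = madd (Omega_bar n \<Omega>) \<Gamma>
      in accurate p {Expl, Impl} {1..s}
           (ark_step s Aex (Aex s) (rowsum s Aex) Aim (Aim s) (rowsum s Aim)))"


section \<open>IMEX-MRI-SR methods\<close>

text \<open>\<open>s\<close> is the number of slow stages, \<open>n\<close> the number of matrices \<open>\<Omega> 0, \<dots>, \<Omega> (n - 1)\<close>.\<close>

definition imex_mri_sr ::
  "nat \<Rightarrow> nat \<Rightarrow> (nat \<Rightarrow> mtx) \<Rightarrow> mtx \<Rightarrow> (nat \<Rightarrow> real) \<Rightarrow> bool" where
  "imex_mri_sr s n \<Omega> \<Gamma> c \<longleftrightarrow>
     1 \<le> s \<and> 1 \<le> n \<and>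
     (\<forall>k<n. \<forall>i\<in>{1..s}. \<forall>j\<in>{1..s}. i \<le> j \<longrightarrow> \<Omega> k i j = 0) \<and>
     (\<forall>i\<in>{1..s}. \<forall>j\<in>{1..s}. i < j \<longrightarrow> \<Gamma> i j = 0) \<and>
     (\<forall>j\<in>{1..s}. \<Gamma> 1 j = 0) \<and>
     c 1 = 0 \<and> (\<forall>i\<in>{2..s}. c i \<noteq> 0)"

definition omega :: "nat \<Rightarrow> (nat \<Rightarrow> mtx) \<Rightarrow> nat \<Rightarrow> nat \<Rightarrow> real \<Rightarrow> real" where
  "omega n \<Omega> i j \<tau> = (\<Sum>k<n. \<Omega> k i j * \<tau> ^ k)"

text \<open>\<open>Slow i\<close> indexes the slow stage \<open>Y\<^sub>i\<close>, and \<open>FastSt i j\<close> the \<open>j\<close>-th internal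
  Runge--Kutta stage \<open>V\<^sub>i\<^sub>,\<^sub>j\<close> of the fast subproblem belonging to \<open>Y\<^sub>i\<close>.\<close>

datatype mri_stage = Slow nat | FastSt nat nat

definition mri_stages :: "nat \<Rightarrow> nat \<Rightarrow> mri_stage set" where
  "mri_stages s sF = Slow ` {1..s} \<union> (\<lambda>(i, j). FastSt i j) ` ({2..s} \<times> {1..sF})"

definition mri_step ::
  "nat \<Rightarrow> nat \<Rightarrow> (nat \<Rightarrow> mtx) \<Rightarrow> mtx \<Rightarrow> (nat \<Rightarrow> real) \<Rightarrow>
   nat \<Rightarrow> mtx \<Rightarrow> (nat \<Rightarrow> real) \<Rightarrow> (nat \<Rightarrow> real) \<Rightarrow> mri_stage step_rel" where
  "mri_step s n \<Omega> \<Gamma> c sF AF bF cF d f t0 y0 H Y z \<longleftrightarrow>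
     (let fE = (\<lambda>j. f Expl (t0 + c j * H) (Y (Slow j)));
          fI = (\<lambda>j. f Impl (t0 + c j * H) (Y (Slow j)));
          fF = (\<lambda>i k. f Fast (t0 + c i * cF k * H) (Y (FastSt i k)));
          v = (\<lambda>i \<kappa>. y0 \<kappa> + c i * H * (\<Sum>j=1..sF. bF j * fF i j \<kappa>)
                + H * (\<Sum>j=1..sF. bF j *
                        (\<Sum>l=1..i - 1. omega n \<Omega> i l (cF j) * (fE l \<kappa> + fI l \<kappa>))))
      in (\<forall>\<kappa><d. Y (Slow 1) \<kappa> = y0 \<kappa>) \<and>
         (\<forall>i\<in>{2..s}. \<forall>j\<in>{1..sF}. \<forall>\<kappa><d.
            Y (FastSt i j) \<kappa> = y0 \<kappa> + c i * H * (\<Sum>k=1..sF. AF j k * fF i k \<kappa>)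
              + H * (\<Sum>k=1..sF. AF j k *
                      (\<Sum>l=1..i - 1. omega n \<Omega> i l (cF k) * (fE l \<kappa> + fI l \<kappa>)))) \<and>
         (\<forall>i\<in>{2..s}. \<forall>\<kappa><d.
            Y (Slow i) \<kappa> = v i \<kappa> + H * (\<Sum>j=1..i. \<Gamma> i j * fI j \<kappa>)) \<and>
         (\<forall>\<kappa><d. z \<kappa> = Y (Slow s) \<kappa>))"

definition mri_accurate ::
  "nat \<Rightarrow> nat \<Rightarrow> nat \<Rightarrow> (nat \<Rightarrow> mtx) \<Rightarrow> mtx \<Rightarrow> (nat \<Rightarrow> real) \<Rightarrow>
   nat \<Rightarrow> mtx \<Rightarrow> (nat \<Rightarrow> real) \<Rightarrow> (nat \<Rightarrow> real) \<Rightarrow> bool" where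
  "mri_accurate p s n \<Omega> \<Gamma> c sF AF bF cF \<longleftrightarrow>
     accurate p UNIV (mri_stages s sF) (mri_step s n \<Omega> \<Gamma> c sF AF bF cF)"


section \<open>GARK tableaux and internal consistency\<close>

text \<open>
  Rows or columns belonging to the fast stages are indexed by pairs, the Kronecker product having
  the entries \<open>(P \<otimes> Q) (i, j) (l, m) = P i l * Q j m\<close>. If \<open>Q\<close> is a single column
  (as in \<open>\<Omega> k \<otimes> (AF cF\<^sup>k)\<close>) or a single row (as in \<open>diag c \<otimes> bF\<^sup>T\<close>), its trivial index
  is dropped.
\<close>

definition A_FF :: "(nat \<Rightarrow> real) \<Rightarrow> mtx \<Rightarrow> nat \<times> nat \<Rightarrow> nat \<times> nat \<Rightarrow> real" where
  "A_FF c AF = (\<lambda>(i, j) (l, m). diag c i l * AF j m)"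

definition A_FE ::
  "nat \<Rightarrow> (nat \<Rightarrow> mtx) \<Rightarrow> nat \<Rightarrow> mtx \<Rightarrow> (nat \<Rightarrow> real) \<Rightarrow> nat \<times> nat \<Rightarrow> nat \<Rightarrow> real" where
  "A_FE n \<Omega> sF AF cF = (\<lambda>(i, j) l. \<Sum>k<n. \<Omega> k i l * mv sF AF (\<lambda>m. cF m ^ k) j)"

definition A_FI ::
  "nat \<Rightarrow> (nat \<Rightarrow> mtx) \<Rightarrow> nat \<Rightarrow> mtx \<Rightarrow> (nat \<Rightarrow> real) \<Rightarrow> nat \<times> nat \<Rightarrow> nat \<Rightarrow> real" where
  "A_FI = A_FE"

definition A_SF :: "(nat \<Rightarrow> real) \<Rightarrow> (nat \<Rightarrow> real) \<Rightarrow> nat \<Rightarrow> nat \<times> nat \<Rightarrow> real" where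
  "A_SF c bF = (\<lambda>i (l, m). diag c i l * bF m)"

definition A_SE :: "nat \<Rightarrow> (nat \<Rightarrow> mtx) \<Rightarrow> mtx" where
  "A_SE n \<Omega> = Omega_bar n \<Omega>"

definition A_SI :: "nat \<Rightarrow> (nat \<Rightarrow> mtx) \<Rightarrow> mtx \<Rightarrow> mtx" where
  "A_SI n \<Omega> \<Gamma> = madd (Omega_bar n \<Omega>) \<Gamma>"

definition internally_consistent ::
  "nat \<Rightarrow> nat \<Rightarrow> (nat \<Rightarrow> mtx) \<Rightarrow> mtx \<Rightarrow> (nat \<Rightarrow> real) \<Rightarrow>
   nat \<Rightarrow> mtx \<Rightarrow> (nat \<Rightarrow> real) \<Rightarrow> (nat \<Rightarrow> real) \<Rightarrow> bool" where
  "internally_consistent s n \<Omega> \<Gamma> c sF AF bF cF \<longleftrightarrow>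
     (let F = {1..s} \<times> {1..sF}; S = {1..s} in
      (\<forall>r\<in>F. (\<Sum>q\<in>F. A_FF c AF r q) = (\<Sum>l\<in>S. A_FE n \<Omega> sF AF cF r l) \<and>
             (\<Sum>l\<in>S. A_FE n \<Omega> sF AF cF r l) = (\<Sum>l\<in>S. A_FI n \<Omega> sF AF cF r l)) \<and>
      (\<forall>i\<in>S. (\<Sum>q\<in>F. A_SF c bF i q) = c i \<and>
             (\<Sum>l\<in>S. A_SE n \<Omega> i l) = c i \<and>
             (\<Sum>l\<in>S. A_SI n \<Omega> \<Gamma> i l) = c i))"

end

theory Submission
  imports Defs
begin

text \<open>
  All stages, fast and slow, are stages of one additive method with a common abscissa. By internal
  consistency the difference \<open>E\<close> between a stage and the exact solution at its abscissa is
  \<open>O(H\<^sup>2)\<close>, so terms quadratic in \<open>E\<close> first contribute at \<open>O(H\<^sup>5)\<close> and the error recursion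
  may be linearised. Order four thus reduces to the quadrature conditions of the last stage and to
  four linear conditions on the stage defects \<open>\<Sum>a c\<^sup>k - c\<^sup>k\<^sup>+\<^sup>1 / (k + 1)\<close>.

  The order conditions of the fast and the slow method are recovered from their accuracy by testing
  them on triangular systems. For the fast method the values of \<open>b\<^sup>T A c\<^sup>k\<close>,
  \<open>b\<^sup>T C A c\<^sup>k\<close> and \<open>b\<^sup>T A A c\<^sup>k\<close> are the weights of the coupling conditions; the third is the
  difference of the first two, which is why no hypothesis with the weights
  \<open>1 / ((k + 1) (k + 2) (k + 3))\<close> is needed.
\<close>


section \<open>Calculus of right-hand sides\<close>

text \<open>Accuracy is an analytic notion here, and all that is given about the stages is that they
  solve their equations and tend to the initial value. Every rate must therefore be won by
  bootstrapping: the stage equations multiply \<open>f\<close> by \<open>H\<close>, so a bound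
  O(H^i) on the stage errors improves to O(H^(i+1)), until the stage defects stop it at O(H^2). Each
  fast subproblem restarts from the initial value. Hence the last slow stage sees directly only the
  fast stages of its own subproblem; those of earlier subproblems act through the earlier slow
  stages. The coupling conditions thus correspond to the patterns of fast and slow parts along a
  chain of at most three evaluations. The forcing polynomials have powers up to n - 1. Evaluating
  the weight b^T C A c^k for all k < n asks for fast order k + 3, which explains the entry n + 2 in
  the order of the fast method.\<close>

lemma tendsto_coordinatewise_state:
  fixes X :: "'a \<Rightarrow> state"
  assumes "\<And>\<kappa>. ((\<lambda>v. X v \<kappa>) \<longlongrightarrow> x \<kappa>) F"
  shows "(X \<longlongrightarrow> x) F"
proof -
  have "limitin (product_topology (\<lambda>_. euclidean) UNIV) X x F"
    unfolding limitin_componentwise using assms by auto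
  then show ?thesis
    by (simp add: euclidean_product_topology)
qed

lemma continuous_rhs_tendsto:
  fixes g :: "real \<Rightarrow> state \<Rightarrow> real"
  assumes "continuous_on UNIV (\<lambda>(t, x). g t x)"
    and "(\<tau> \<longlongrightarrow> t) F" and "\<And>\<kappa>. ((\<lambda>v. X v \<kappa>) \<longlongrightarrow> x \<kappa>) F"
  shows "((\<lambda>v. g (\<tau> v) (X v)) \<longlongrightarrow> g t x) F"
proof -
  have "((\<lambda>v. (\<tau> v, X v)) \<longlongrightarrow> (t, x)) F"
    using assms(2) tendsto_coordinatewise_state[OF assms(3)] by (rule tendsto_Pair)
  from continuous_on_tendsto_compose[OF assms(1) this] show ?thesis
    by simp
qed

lemma mvt_between:
  fixes \<phi> :: "real \<Rightarrow> real"
  assumes "\<And>s. (\<phi> has_real_derivative \<phi>' s) (at s)"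
  shows "\<exists>\<zeta>. \<phi> b - \<phi> a = (b - a) * \<phi>' \<zeta> \<and> \<bar>\<zeta> - a\<bar> \<le> \<bar>b - a\<bar>"
proof (cases a b rule: linorder_cases)
  case less
  then obtain z where "a < z" "z < b" "\<phi> b - \<phi> a = (b - a) * \<phi>' z"
    using MVT2[of a b \<phi> \<phi>'] assms by blast
  then show ?thesis by (intro exI[of _ z]) auto
next
  case greater
  then obtain z where "b < z" "z < a" "\<phi> a - \<phi> b = (a - b) * \<phi>' z"
    using MVT2[of b a \<phi> \<phi>'] assms by blast
  then show ?thesis by (intro exI[of _ z]) (auto simp: algebra_simps)
qed auto

text \<open>The function \<open>G v\<close> itself moves with \<open>v\<close>, so the one-variable
  chain rule does not apply. The mean value theorem in the second argument shifts the quotient to an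
  intermediate point squeezed towards \<open>a u\<close>, where joint continuity of the partial
  derivative will supply the limit.\<close>

lemma diff_quotient_tendsto:
  fixes G :: "real \<Rightarrow> real \<Rightarrow> real"
  assumes der: "\<And>v s. (G v has_real_derivative G' v s) (at s)"
    and a: "(a has_real_derivative a') (at u)"
    and lim: "\<And>\<zeta>. (\<zeta> \<longlongrightarrow> a u) (at u) \<Longrightarrow> ((\<lambda>v. G' v (\<zeta> v)) \<longlongrightarrow> L) (at u)"
  shows "((\<lambda>v. (G v (a v) - G v (a u)) / (v - u)) \<longlongrightarrow> L * a') (at u)"
proof -
  have "\<exists>\<zeta>. \<forall>v. G v (a v) - G v (a u) = (a v - a u) * G' v (\<zeta> v) \<and> \<bar>\<zeta> v - a u\<bar> \<le> \<bar>a v - a u\<bar>"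
    by (intro choice allI mvt_between der)
  then obtain \<zeta> where \<zeta>: "\<And>v. G v (a v) - G v (a u) = (a v - a u) * G' v (\<zeta> v)"
      "\<And>v. \<bar>\<zeta> v - a u\<bar> \<le> \<bar>a v - a u\<bar>"
    by blast
  have "(a \<longlongrightarrow> a u) (at u)"
    using DERIV_isCont[OF a] by (simp add: isCont_def)
  then have "((\<lambda>v. \<bar>a v - a u\<bar>) \<longlongrightarrow> 0) (at u)"
    using LIM_zero tendsto_rabs_zero by blast
  then have "((\<lambda>v. \<zeta> v - a u) \<longlongrightarrow> 0) (at u)"
    by (rule Lim_null_comparison[rotated]) (simp add: \<zeta>(2))
  then have "(\<zeta> \<longlongrightarrow> a u) (at u)"
    by (rule LIM_zero_cancel)
  from lim[OF this] a[unfolded has_field_derivative_iff]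
  have "((\<lambda>v. G' v (\<zeta> v) * ((a v - a u) / (v - u))) \<longlongrightarrow> L * a') (at u)"
    by (rule tendsto_mult)
  then show ?thesis
    by (simp add: \<zeta>(1) mult.commute)
qed

text \<open>Only coordinatewise derivatives are given and the state space carries no norm, so there
  is no total derivative to work with. The increment is telescoped over the states
  \<open>mix k v\<close>, which move one coordinate at a time; coordinates from \<open>d\<close> on
  have no partial derivative and must be constant.\<close>

lemma chain_rule_partials:
  fixes g :: "real \<Rightarrow> state \<Rightarrow> real"
  assumes gt: "\<And>t x. ((\<lambda>s. g s x) has_real_derivative gt t x) (at t)"
    and gt_cont: "continuous_on UNIV (\<lambda>(t, x). gt t x)"
    and gx: "\<And>\<kappa> t x. \<kappa> < d \<Longrightarrow> ((\<lambda>s. g t (x(\<kappa> := s))) has_real_derivative gx \<kappa> t x) (at (x \<kappa>))"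
    and gx_cont: "\<And>\<kappa>. \<kappa> < d \<Longrightarrow> continuous_on UNIV (\<lambda>(t, x). gx \<kappa> t x)"
    and \<tau>: "(\<tau> has_real_derivative \<tau>') (at u)"
    and \<xi>: "\<And>\<kappa>. \<kappa> < d \<Longrightarrow> ((\<lambda>v. \<xi> v \<kappa>) has_real_derivative \<xi>' \<kappa>) (at u)"
    and const: "\<And>\<kappa> v. \<kappa> \<ge> d \<Longrightarrow> \<xi> v \<kappa> = \<xi> u \<kappa>"
  shows "((\<lambda>v. g (\<tau> v) (\<xi> v)) has_real_derivative
           gt (\<tau> u) (\<xi> u) * \<tau>' + (\<Sum>\<kappa><d. gx \<kappa> (\<tau> u) (\<xi> u) * \<xi>' \<kappa>)) (at u)"
proof -
  define mix where "mix k v = (\<lambda>\<kappa>. if \<kappa> < k then \<xi> v \<kappa> else \<xi> u \<kappa>)" for k :: nat and v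
  have mix_d: "mix d v = \<xi> v" for v
    unfolding mix_def by (rule ext) (metis const not_less)
  have mix_0: "mix 0 v = \<xi> u" for v
    by (auto simp: mix_def)
  have upd: "mix (Suc k) v = (mix k v)(k := \<xi> v k)" "mix k v = (mix k v)(k := \<xi> u k)" for k v
    by (auto simp: mix_def fun_eq_iff)
  have \<tau>_lim: "(\<tau> \<longlongrightarrow> \<tau> u) (at u)"
    using DERIV_isCont[OF \<tau>] by (simp add: isCont_def)
  have \<xi>_lim: "((\<lambda>v. \<xi> v \<kappa>) \<longlongrightarrow> \<xi> u \<kappa>) (at u)" for \<kappa>
  proof (cases "\<kappa> < d")
    case True
    then show ?thesis
      using DERIV_isCont[OF \<xi>[OF True]] by (simp add: isCont_def)
  next
    case False
    then have "(\<lambda>v. \<xi> v \<kappa>) = (\<lambda>v. \<xi> u \<kappa>)"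
      by (intro ext const) simp
    then show ?thesis
      by simp
  qed
  have mix_lim: "((\<lambda>v. mix k v \<kappa>) \<longlongrightarrow> \<xi> u \<kappa>) (at u)" for k \<kappa>
    by (cases "\<kappa> < k") (simp_all add: mix_def \<xi>_lim)
  have time: "((\<lambda>v. (g (\<tau> v) (\<xi> u) - g (\<tau> u) (\<xi> u)) / (v - u)) \<longlongrightarrow> gt (\<tau> u) (\<xi> u) * \<tau>') (at u)"
    by (rule diff_quotient_tendsto[where G = "\<lambda>v s. g s (\<xi> u)" and G' = "\<lambda>v s. gt s (\<xi> u)"])
       (auto intro!: gt \<tau> continuous_rhs_tendsto[OF gt_cont])
  have space: "((\<lambda>v. (g (\<tau> v) (mix (Suc k) v) - g (\<tau> v) (mix k v)) / (v - u))
      \<longlongrightarrow> gx k (\<tau> u) (\<xi> u) * \<xi>' k) (at u)" if "k < d" for k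
  proof -
    have "((\<lambda>v. (g (\<tau> v) ((mix k v)(k := \<xi> v k)) - g (\<tau> v) ((mix k v)(k := \<xi> u k))) / (v - u))
      \<longlongrightarrow> gx k (\<tau> u) (\<xi> u) * \<xi>' k) (at u)"
    proof (rule diff_quotient_tendsto[where a = "\<lambda>v. \<xi> v k" and G = "\<lambda>v s. g (\<tau> v) ((mix k v)(k := s))"
          and G' = "\<lambda>v s. gx k (\<tau> v) ((mix k v)(k := s))"])
      show "((\<lambda>s. g (\<tau> v) ((mix k v)(k := s))) has_real_derivative gx k (\<tau> v) ((mix k v)(k := s))) (at s)"
        for v s
        using gx[OF that, of "\<tau> v" "(mix k v)(k := s)"] by simp
      show "((\<lambda>v. \<xi> v k) has_real_derivative \<xi>' k) (at u)"
        by (rule \<xi>[OF that])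
      show "((\<lambda>v. gx k (\<tau> v) ((mix k v)(k := \<zeta> v))) \<longlongrightarrow> gx k (\<tau> u) (\<xi> u)) (at u)"
        if "(\<zeta> \<longlongrightarrow> \<xi> u k) (at u)" for \<zeta>
      proof (intro continuous_rhs_tendsto[OF gx_cont[OF \<open>k < d\<close>]] \<tau>_lim)
        show "((\<lambda>v. ((mix k v)(k := \<zeta> v)) \<kappa>) \<longlongrightarrow> \<xi> u \<kappa>) (at u)" for \<kappa>
          using that mix_lim by (cases "\<kappa> = k") auto
      qed
    qed
    then show ?thesis
      unfolding upd(1) using upd(2) by simp
  qed
  have tel: "g (\<tau> v) (\<xi> v) - g (\<tau> u) (\<xi> u) = (g (\<tau> v) (\<xi> u) - g (\<tau> u) (\<xi> u)) +
      (\<Sum>k<d. g (\<tau> v) (mix (Suc k) v) - g (\<tau> v) (mix k v))" for v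
    by (subst sum_lessThan_telescope) (simp add: mix_d mix_0)
  have eq: "(g (\<tau> v) (\<xi> v) - g (\<tau> u) (\<xi> u)) / (v - u) =
      (g (\<tau> v) (\<xi> u) - g (\<tau> u) (\<xi> u)) / (v - u) +
      (\<Sum>k<d. (g (\<tau> v) (mix (Suc k) v) - g (\<tau> v) (mix k v)) / (v - u))" for v
    by (simp only: tel[of v] add_divide_distrib sum_divide_distrib)
  show ?thesis
    unfolding has_field_derivative_iff eq by (intro tendsto_add time tendsto_sum space) simp
qed

section \<open>Smooth functions and Landau estimates of their increments\<close>

lemma Ck_continuous: "Ck d m g \<Longrightarrow> continuous_on UNIV (\<lambda>(t, x). g t x)"
  by (cases m) auto

lemma Ck_SucE:
  assumes "Ck d (Suc m) g"
  obtains gt gx where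
    "\<And>t x. ((\<lambda>s. g s x) has_real_derivative gt t x) (at t)" "Ck d m gt"
    "\<And>\<kappa> t x. \<kappa> < d \<Longrightarrow> ((\<lambda>s. g t (x(\<kappa> := s))) has_real_derivative gx \<kappa> t x) (at (x \<kappa>))"
    "\<And>\<kappa>. \<kappa> < d \<Longrightarrow> Ck d m (gx \<kappa>)"
proof -
  have "\<forall>\<kappa>. \<exists>h. \<kappa> < d \<longrightarrow>
      (\<forall>t x. ((\<lambda>s. g t (x(\<kappa> := s))) has_real_derivative h t x) (at (x \<kappa>))) \<and> Ck d m h"
    using assms by auto
  then obtain gx where "\<forall>\<kappa>. \<kappa> < d \<longrightarrow>
      (\<forall>t x. ((\<lambda>s. g t (x(\<kappa> := s))) has_real_derivative gx \<kappa> t x) (at (x \<kappa>))) \<and> Ck d m (gx \<kappa>)"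
    using choice[of "\<lambda>\<kappa> h. \<kappa> < d \<longrightarrow>
      (\<forall>t x. ((\<lambda>s. g t (x(\<kappa> := s))) has_real_derivative h t x) (at (x \<kappa>))) \<and> Ck d m h"] by blast
  moreover obtain gt where "\<And>t x. ((\<lambda>s. g s x) has_real_derivative gt t x) (at t)" "Ck d m gt"
    using assms by auto
  ultimately show ?thesis
    by (intro that[of gt gx]) blast+
qed

text \<open>Integration gains one power. The set \<open>S\<close> lets one statement serve both the
  polynomials, known on both sides of 0 (\<open>S = UNIV\<close>), and the exact solution,
  differentiable only relative to \<open>{0..T}\<close>.\<close>

lemma bigo_integrate:
  fixes \<phi> :: "real \<Rightarrow> real"
  assumes seg: "\<And>h. h \<in> S \<Longrightarrow> closed_segment 0 h \<subseteq> S"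
    and der: "\<And>h. h \<in> S \<Longrightarrow> (\<phi> has_real_derivative \<phi>' h) (at h within S)"
    and bd: "\<phi>' \<in> O[inf (nhds 0) (principal S)](\<lambda>h. h ^ m)"
  shows "(\<lambda>h. \<phi> h - \<phi> 0) \<in> O[inf (nhds 0) (principal S)](\<lambda>h. h ^ Suc m)"
proof -
  obtain C where "C > 0" and
    "eventually (\<lambda>h. norm (\<phi>' h) \<le> C * norm (h ^ m)) (inf (nhds 0) (principal S))"
    using bd by (elim landau_o.bigE)
  then obtain \<delta> where "\<delta> > 0" and \<delta>: "\<And>h. \<bar>h\<bar> < \<delta> \<Longrightarrow> h \<in> S \<Longrightarrow> \<bar>\<phi>' h\<bar> \<le> C * \<bar>h\<bar> ^ m"
    by (auto simp: eventually_inf_principal eventually_nhds_metric dist_real_def power_abs)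
  have "norm (\<phi> h - \<phi> 0) \<le> C * norm (h ^ Suc m)" if "\<bar>h\<bar> < \<delta>" "h \<in> S" for h
  proof -
    have "norm (\<phi> h - \<phi> 0) \<le> (C * \<bar>h\<bar> ^ m) * norm (h - 0)"
    proof (rule field_differentiable_bound[of "closed_segment 0 h"])
      fix z assume z: "z \<in> closed_segment 0 h"
      then have "\<bar>z\<bar> \<le> \<bar>h\<bar>"
        by (auto simp: closed_segment_eq_real_ivl split: if_splits)
      moreover have "z \<in> S"
        using z seg that by blast
      ultimately have "\<bar>\<phi>' z\<bar> \<le> C * \<bar>z\<bar> ^ m"
        using \<delta>[of z] that by simp
      also have "\<dots> \<le> C * \<bar>h\<bar> ^ m"
        using \<open>C > 0\<close> \<open>\<bar>z\<bar> \<le> \<bar>h\<bar>\<close> by (intro mult_left_mono power_mono) auto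
      finally show "norm (\<phi>' z) \<le> C * \<bar>h\<bar> ^ m"
        by simp
      show "(\<phi> has_field_derivative \<phi>' z) (at z within closed_segment 0 h)"
        using der[OF \<open>z \<in> S\<close>] seg[OF that(2)] by (rule DERIV_subset)
    qed auto
    then show ?thesis
      by (simp add: abs_mult power_abs mult_ac)
  qed
  moreover have "eventually (\<lambda>h. \<bar>h\<bar> < \<delta>) (nhds (0::real))"
    using \<open>\<delta> > 0\<close> by (auto simp: eventually_nhds_metric dist_real_def)
  ultimately show ?thesis
    unfolding bigo_def eventually_inf_principal
    using \<open>C > 0\<close> by (auto elim!: eventually_mono)
qed

text \<open>The mean value theorem is applied to a function of one real variable on the segment from
  \<open>x\<close> to \<open>x + e\<close>, so a single \<open>\<zeta>\<close> serves all
  coordinates.\<close>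

lemma segment_mvt:
  fixes g :: "real \<Rightarrow> state \<Rightarrow> real"
  assumes "\<And>t x. ((\<lambda>s. g s x) has_real_derivative gt t x) (at t)"
    and "continuous_on UNIV (\<lambda>(t, x). gt t x)"
    and "\<And>\<kappa> t x. \<kappa> < d \<Longrightarrow> ((\<lambda>s. g t (x(\<kappa> := s))) has_real_derivative gx \<kappa> t x) (at (x \<kappa>))"
    and "\<And>\<kappa>. \<kappa> < d \<Longrightarrow> continuous_on UNIV (\<lambda>(t, x). gx \<kappa> t x)"
    and e: "\<And>\<kappa>. \<kappa> \<ge> d \<Longrightarrow> e \<kappa> = 0"
  shows "\<exists>\<zeta>. g t (\<lambda>\<kappa>. x \<kappa> + e \<kappa>) - g t x = (\<Sum>\<kappa><d. gx \<kappa> t (\<lambda>\<kappa>. x \<kappa> + \<zeta> * e \<kappa>) * e \<kappa>) \<and> \<bar>\<zeta>\<bar> \<le> 1"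
proof -
  have "((\<lambda>u. g t (\<lambda>\<kappa>. x \<kappa> + u * e \<kappa>)) has_real_derivative
      gt t (\<lambda>\<kappa>. x \<kappa> + u * e \<kappa>) * 0 + (\<Sum>\<kappa><d. gx \<kappa> t (\<lambda>\<kappa>. x \<kappa> + u * e \<kappa>) * e \<kappa>)) (at u)" for u
  proof (rule chain_rule_partials[where \<tau> = "\<lambda>_. t" and \<xi> = "\<lambda>u \<kappa>. x \<kappa> + u * e \<kappa>", OF assms(1-4)])
    show "((\<lambda>v. x \<kappa> + v * e \<kappa>) has_real_derivative e \<kappa>) (at u)" for \<kappa>
      by (auto intro!: derivative_eq_intros)
  qed (auto simp: e)
  then have "((\<lambda>u. g t (\<lambda>\<kappa>. x \<kappa> + u * e \<kappa>)) has_real_derivative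
      (\<Sum>\<kappa><d. gx \<kappa> t (\<lambda>\<kappa>. x \<kappa> + u * e \<kappa>) * e \<kappa>)) (at u)" for u
    by simp
  from mvt_between[OF this, of 1 0] show ?thesis
    by auto
qed

text \<open>The gradient at the intermediate points converges to its value at \<open>p\<close>,
  hence is bounded. Convergence of \<open>E\<close> and its rate \<open>B\<close> are separate
  assumptions, so that a bootstrap can start with the constant rate.\<close>

lemma Ck_lipschitz:
  assumes g: "Ck d (Suc m) g"
    and t: "(t \<longlongrightarrow> r) F" and X: "\<And>\<kappa>. ((\<lambda>v. X v \<kappa>) \<longlongrightarrow> p \<kappa>) F"
    and E: "\<And>\<kappa>. \<kappa> < d \<Longrightarrow> ((\<lambda>v. E v \<kappa>) \<longlongrightarrow> 0) F"
    and EB: "\<And>\<kappa>. \<kappa> < d \<Longrightarrow> (\<lambda>v. E v \<kappa>) \<in> O[F](B)"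
    and E0: "\<And>\<kappa> v. \<kappa> \<ge> d \<Longrightarrow> E v \<kappa> = 0"
  shows "(\<lambda>v. g (t v) (\<lambda>\<kappa>. X v \<kappa> + E v \<kappa>) - g (t v) (X v)) \<in> O[F](B)"
proof -
  obtain gt gx where part:
    "\<And>t x. ((\<lambda>s. g s x) has_real_derivative gt t x) (at t)" "Ck d m gt"
    "\<And>\<kappa> t x. \<kappa> < d \<Longrightarrow> ((\<lambda>s. g t (x(\<kappa> := s))) has_real_derivative gx \<kappa> t x) (at (x \<kappa>))"
    "\<And>\<kappa>. \<kappa> < d \<Longrightarrow> Ck d m (gx \<kappa>)"
    using Ck_SucE[OF g] by metis
  have "\<exists>\<zeta>. \<forall>v. g (t v) (\<lambda>\<kappa>. X v \<kappa> + E v \<kappa>) - g (t v) (X v) =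
      (\<Sum>\<kappa><d. gx \<kappa> (t v) (\<lambda>\<kappa>. X v \<kappa> + \<zeta> v * E v \<kappa>) * E v \<kappa>) \<and> \<bar>\<zeta> v\<bar> \<le> 1"
    by (intro choice allI segment_mvt[OF part(1) Ck_continuous[OF part(2)] part(3) Ck_continuous[OF part(4)]] E0)
  then obtain \<zeta> where \<zeta>: "\<And>v. g (t v) (\<lambda>\<kappa>. X v \<kappa> + E v \<kappa>) - g (t v) (X v) =
      (\<Sum>\<kappa><d. gx \<kappa> (t v) (\<lambda>\<kappa>. X v \<kappa> + \<zeta> v * E v \<kappa>) * E v \<kappa>)" "\<And>v. \<bar>\<zeta> v\<bar> \<le> 1"
    by blast
  have lim: "((\<lambda>v. X v \<kappa> + \<zeta> v * E v \<kappa>) \<longlongrightarrow> p \<kappa>) F" for \<kappa>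
  proof -
    have "((\<lambda>v. E v \<kappa>) \<longlongrightarrow> 0) F"
      using E E0 by (cases "\<kappa> < d") auto
    then have "((\<lambda>v. \<zeta> v * E v \<kappa>) \<longlongrightarrow> 0) F"
      by (rule Lim_null_comparison[rotated, OF tendsto_rabs_zero])
         (simp add: abs_mult mult_left_le_one_le \<zeta>(2))
    from tendsto_add[OF X this] show ?thesis
      by simp
  qed
  have "(\<lambda>v. gx \<kappa> (t v) (\<lambda>\<kappa>. X v \<kappa> + \<zeta> v * E v \<kappa>) * E v \<kappa>) \<in> O[F](\<lambda>v. 1 * B v)" if "\<kappa> < d" for \<kappa>
  proof (intro landau_o.big.mult EB that)
    show "(\<lambda>v. gx \<kappa> (t v) (\<lambda>\<kappa>. X v \<kappa> + \<zeta> v * E v \<kappa>)) \<in> O[F](\<lambda>_. 1)"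
      by (rule bigoI_tendsto[where c = "gx \<kappa> r p"])
         (use continuous_rhs_tendsto[OF Ck_continuous[OF part(4)[OF that]] t lim] in auto)
  qed
  then show ?thesis
    unfolding \<zeta>(1) by (intro big_sum_in_bigo) auto
qed

text \<open>The remainder is the difference of gradients at the intermediate point and at
  \<open>X\<close>, times \<open>E\<close>. Applying the Lipschitz estimate to the gradient gives
  the second factor \<open>B\<close> without a second-order expansion.\<close>

lemma Ck_linearize:
  assumes part:
    "\<And>t x. ((\<lambda>s. g s x) has_real_derivative gt t x) (at t)"
    "continuous_on UNIV (\<lambda>(t, x). gt t x)"
    "\<And>\<kappa> t x. \<kappa> < d \<Longrightarrow> ((\<lambda>s. g t (x(\<kappa> := s))) has_real_derivative gx \<kappa> t x) (at (x \<kappa>))"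
    "\<And>\<kappa>. \<kappa> < d \<Longrightarrow> Ck d (Suc m) (gx \<kappa>)"
    and t: "(t \<longlongrightarrow> r) F" and X: "\<And>\<kappa>. ((\<lambda>v. X v \<kappa>) \<longlongrightarrow> p \<kappa>) F"
    and E: "\<And>\<kappa>. \<kappa> < d \<Longrightarrow> ((\<lambda>v. E v \<kappa>) \<longlongrightarrow> 0) F"
    and EB: "\<And>\<kappa>. \<kappa> < d \<Longrightarrow> (\<lambda>v. E v \<kappa>) \<in> O[F](B)"
    and E0: "\<And>\<kappa> v. \<kappa> \<ge> d \<Longrightarrow> E v \<kappa> = 0"
  shows "(\<lambda>v. g (t v) (\<lambda>\<kappa>. X v \<kappa> + E v \<kappa>) - g (t v) (X v)
           - (\<Sum>\<kappa><d. gx \<kappa> (t v) (X v) * E v \<kappa>)) \<in> O[F](\<lambda>v. B v * B v)"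
proof -
  have "\<exists>\<zeta>. \<forall>v. g (t v) (\<lambda>\<kappa>. X v \<kappa> + E v \<kappa>) - g (t v) (X v) =
      (\<Sum>\<kappa><d. gx \<kappa> (t v) (\<lambda>\<kappa>. X v \<kappa> + \<zeta> v * E v \<kappa>) * E v \<kappa>) \<and> \<bar>\<zeta> v\<bar> \<le> 1"
    by (intro choice allI segment_mvt[OF part(1-3) Ck_continuous[OF part(4)]] E0)
  then obtain \<zeta> where \<zeta>: "\<And>v. g (t v) (\<lambda>\<kappa>. X v \<kappa> + E v \<kappa>) - g (t v) (X v) =
      (\<Sum>\<kappa><d. gx \<kappa> (t v) (\<lambda>\<kappa>. X v \<kappa> + \<zeta> v * E v \<kappa>) * E v \<kappa>)" "\<And>v. \<bar>\<zeta> v\<bar> \<le> 1"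
    by blast
  have \<zeta>E: "\<bar>\<zeta> v * E v \<kappa>\<bar> \<le> \<bar>E v \<kappa>\<bar>" for v \<kappa>
    by (simp add: abs_mult mult_left_le_one_le \<zeta>(2))
  have "(\<lambda>v. (gx \<kappa> (t v) (\<lambda>\<kappa>. X v \<kappa> + \<zeta> v * E v \<kappa>) - gx \<kappa> (t v) (X v)) * E v \<kappa>) \<in> O[F](\<lambda>v. B v * B v)"
    if "\<kappa> < d" for \<kappa>
  proof (intro landau_o.big.mult EB that Ck_lipschitz[OF part(4)[OF that] t X])
    show "((\<lambda>v. \<zeta> v * E v \<mu>) \<longlongrightarrow> 0) F" if "\<mu> < d" for \<mu>
      by (rule Lim_null_comparison[rotated, OF tendsto_rabs_zero[OF E[OF that]]]) (simp add: \<zeta>E)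
    show "(\<lambda>v. \<zeta> v * E v \<mu>) \<in> O[F](B)" if "\<mu> < d" for \<mu>
      by (rule landau_o.big_trans[OF bigoI[where c = 1] EB[OF that]]) (simp add: \<zeta>E)
  qed (simp add: E0)
  then have "(\<lambda>v. \<Sum>\<kappa><d. (gx \<kappa> (t v) (\<lambda>\<kappa>. X v \<kappa> + \<zeta> v * E v \<kappa>) - gx \<kappa> (t v) (X v)) * E v \<kappa>)
      \<in> O[F](\<lambda>v. B v * B v)"
    by (intro big_sum_in_bigo) auto
  then show ?thesis
    by (simp add: \<zeta>(1) left_diff_distrib sum_subtractf)
qed

section \<open>Polynomials near 0 and Taylor expansion along polynomial paths\<close>

lemma bigo_power_le:
  fixes \<phi> :: "real \<Rightarrow> real"
  assumes "\<phi> \<in> O[F](\<lambda>h. h ^ k)" "F \<le> nhds 0" "j \<le> k"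
  shows "\<phi> \<in> O[F](\<lambda>h. h ^ j)"
proof -
  have "((\<lambda>h::real. h ^ (k - j)) \<longlongrightarrow> 0 ^ (k - j)) F"
    by (intro tendsto_power) (use assms(2) in \<open>simp add: filterlim_ident filterlim_def\<close>)
  then have "(\<lambda>h::real. h ^ (k - j)) \<in> O[F](\<lambda>_. 1)"
    by (intro bigoI_tendsto[where c = "0 ^ (k - j)"]) auto
  from landau_o.big.mult[OF landau_o.big_refl[of "\<lambda>h. h ^ j" F] this]
  have "(\<lambda>h::real. h ^ k) \<in> O[F](\<lambda>h. h ^ j)"
    using assms(3) by (simp flip: power_add)
  with assms(1) show ?thesis
    by (rule landau_o.big_trans)
qed

lemma poly_bigo_1: "F \<le> nhds 0 \<Longrightarrow> poly (p :: real poly) \<in> O[F](\<lambda>_. 1)"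
proof -
  assume "F \<le> nhds 0"
  then have "(poly p \<longlongrightarrow> poly p 0) F"
    by (intro tendsto_poly) (simp add: filterlim_def)
  then show ?thesis
    by (intro bigoI_tendsto[where c = "poly p 0"]) auto
qed

lemma poly_antiderivative: "\<exists>Q :: real poly. pderiv Q = p \<and> poly Q 0 = a"
proof -
  define Q where "Q = [:a:] + (\<Sum>k\<le>degree p. monom (coeff p k / real (Suc k)) (Suc k))"
  have "coeff Q (Suc n) = coeff p n / real (Suc n)" for n
    by (cases "n \<le> degree p") (auto simp: Q_def coeff_sum sum.delta coeff_eq_0 simp del: of_nat_Suc)
  then have "pderiv Q = p"
    by (intro poly_eqI) (simp add: coeff_pderiv del: of_nat_Suc)
  moreover have "poly Q 0 = a"
    by (simp add: Q_def poly_sum poly_monom)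
  ultimately show ?thesis
    by blast
qed

text \<open>Coordinates from \<open>d\<close> on are frozen at zero, as the chain rule demands
  constancy there.\<close>

definition poly_path :: "nat \<Rightarrow> (nat \<Rightarrow> real poly) \<Rightarrow> real \<Rightarrow> state" where
  "poly_path d P h = (\<lambda>\<kappa>. if \<kappa> < d then poly (P \<kappa>) h else 0)"

lemma poly_path_tendsto:
  assumes "(\<tau> \<longlongrightarrow> 0) F" shows "((\<lambda>v. poly_path d P (\<tau> v) \<kappa>) \<longlongrightarrow> poly_path d P 0 \<kappa>) F"
  using assms by (auto simp: poly_path_def intro!: tendsto_poly)

lemma bigo_integrate_nhds:
  fixes \<phi> :: "real \<Rightarrow> real"
  assumes "\<And>h. (\<phi> has_real_derivative \<phi>' h) (at h)" "\<phi>' \<in> O[nhds 0](\<lambda>h. h ^ m)"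
  shows "(\<lambda>h. \<phi> h - \<phi> 0) \<in> O[nhds 0](\<lambda>h. h ^ Suc m)"
  using bigo_integrate[of UNIV \<phi> \<phi>' m] assms by simp

text \<open>Differentiating along a polynomial path leaves products of functions one degree less
  smooth with polynomials. Their expansions come from the induction hypothesis, and an
  antiderivative with the right initial value gains one power.\<close>

lemma Ck_taylor:
  "Ck d m g \<Longrightarrow> \<exists>q. (\<lambda>h. g (t0 + h) (poly_path d P h) - poly q h) \<in> O[nhds 0](\<lambda>h. h ^ m)"
proof (induction m arbitrary: g)
  case 0
  have "((\<lambda>h. g (t0 + h) (poly_path d P h)) \<longlongrightarrow> g (t0 + 0) (poly_path d P 0)) (nhds 0)"
    by (intro continuous_rhs_tendsto[OF Ck_continuous[OF 0]] tendsto_intros poly_path_tendsto filterlim_ident)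
  then show ?case
    by (intro exI[of _ 0]) (auto intro: bigoI_tendsto)
next
  case (Suc m)
  obtain gt gx where part:
    "\<And>t x. ((\<lambda>s. g s x) has_real_derivative gt t x) (at t)" "Ck d m gt"
    "\<And>\<kappa> t x. \<kappa> < d \<Longrightarrow> ((\<lambda>s. g t (x(\<kappa> := s))) has_real_derivative gx \<kappa> t x) (at (x \<kappa>))"
    "\<And>\<kappa>. \<kappa> < d \<Longrightarrow> Ck d m (gx \<kappa>)"
    using Ck_SucE[OF Suc.prems] by metis
  define \<phi>' where "\<phi>' h = gt (t0 + h) (poly_path d P h) * 1 +
      (\<Sum>\<kappa><d. gx \<kappa> (t0 + h) (poly_path d P h) * poly (pderiv (P \<kappa>)) h)" for h
  have der: "((\<lambda>h. g (t0 + h) (poly_path d P h)) has_real_derivative \<phi>' h) (at h)" for h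
    unfolding \<phi>'_def
  proof (rule chain_rule_partials[where \<tau> = "\<lambda>h. t0 + h" and \<xi> = "poly_path d P",
        OF part(1) Ck_continuous[OF part(2)] part(3) Ck_continuous[OF part(4)]])
    show "((\<lambda>h. t0 + h) has_real_derivative 1) (at h)"
      by (auto intro!: derivative_eq_intros)
  qed (auto simp: poly_path_def poly_DERIV)
  obtain qt where qt: "(\<lambda>h. gt (t0 + h) (poly_path d P h) - poly qt h) \<in> O[nhds 0](\<lambda>h. h ^ m)"
    using Suc.IH[OF part(2)] by blast
  have "\<exists>qx. \<forall>\<kappa>. \<kappa> < d \<longrightarrow> (\<lambda>h. gx \<kappa> (t0 + h) (poly_path d P h) - poly (qx \<kappa>) h) \<in> O[nhds 0](\<lambda>h. h ^ m)"
    by (intro choice) (use Suc.IH[OF part(4)] in blast)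
  then obtain qx where
    qx: "\<And>\<kappa>. \<kappa> < d \<Longrightarrow> (\<lambda>h. gx \<kappa> (t0 + h) (poly_path d P h) - poly (qx \<kappa>) h) \<in> O[nhds 0](\<lambda>h. h ^ m)"
    by blast
  define q' where "q' = qt + (\<Sum>\<kappa><d. qx \<kappa> * pderiv (P \<kappa>))"
  obtain q where q: "pderiv q = q'" "poly q 0 = g t0 (poly_path d P 0)"
    using poly_antiderivative by blast
  have "(\<lambda>h. (gx \<kappa> (t0 + h) (poly_path d P h) - poly (qx \<kappa>) h) * poly (pderiv (P \<kappa>)) h)
      \<in> O[nhds 0](\<lambda>h. h ^ m * 1)" if "\<kappa> < d" for \<kappa>
    by (intro landau_o.big.mult qx that poly_bigo_1) simp
  then have "(\<lambda>h. \<Sum>\<kappa><d. (gx \<kappa> (t0 + h) (poly_path d P h) - poly (qx \<kappa>) h) * poly (pderiv (P \<kappa>)) h)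
      \<in> O[nhds 0](\<lambda>h. h ^ m)"
    by (intro big_sum_in_bigo) auto
  from sum_in_bigo(1)[OF qt this]
  have "(\<lambda>h. \<phi>' h - poly q' h) \<in> O[nhds 0](\<lambda>h. h ^ m)"
    by (simp add: \<phi>'_def q'_def poly_sum left_diff_distrib sum_subtractf algebra_simps)
  moreover have "((\<lambda>h. g (t0 + h) (poly_path d P h) - poly q h) has_real_derivative \<phi>' h - poly q' h) (at h)" for h
    using der q(1) by (auto intro!: derivative_eq_intros poly_DERIV)
  ultimately have "(\<lambda>h. g (t0 + h) (poly_path d P h) - poly q h - (g (t0 + 0) (poly_path d P 0) - poly q 0))
      \<in> O[nhds 0](\<lambda>h. h ^ Suc m)"
    by (intro bigo_integrate_nhds)
  then show ?case
    using q(2) by auto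
qed


section \<open>Comparison with polynomials\<close>

text \<open>Stages and solutions are arbitrary beyond coordinate \<open>d\<close>. Cutting them off
  there permits writing a stage, as a whole function, as a polynomial path plus an error vanishing
  beyond \<open>d\<close>.\<close>

definition trunc :: "nat \<Rightarrow> state \<Rightarrow> state" where
  "trunc d x = (\<lambda>\<kappa>. if \<kappa> < d then x \<kappa> else 0)"

lemma smooth_rhs_trunc: "smooth_rhs d m f \<Longrightarrow> \<kappa> < d \<Longrightarrow> f t x \<kappa> = f t (trunc d x) \<kappa>"
proof -
  assume "smooth_rhs d m f" "\<kappa> < d"
  then have "(\<forall>\<mu><d. x \<mu> = trunc d x \<mu>) \<longrightarrow> f t x \<kappa> = f t (trunc d x) \<kappa>"
    unfolding smooth_rhs_def depends_only_def by blast
  then show ?thesis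
    by (simp add: trunc_def)
qed

lemma smooth_rhs_Ck: "smooth_rhs d m f \<Longrightarrow> \<kappa> < d \<Longrightarrow> Ck d m (\<lambda>t x. f t x \<kappa>)"
  unfolding smooth_rhs_def by blast

text \<open>Picard iteration within polynomials: the right-hand side along the current polynomial is
  replaced by its Taylor polynomial and integrated. No solution of the equation is needed, so the
  result holds on both sides of \<open>t0\<close>.\<close>

lemma picard_poly:
  assumes smooth: "\<And>\<sigma>. \<sigma> \<in> S \<Longrightarrow> smooth_rhs d (Suc m) (f \<sigma>)" and "k \<le> Suc m"
  shows "\<exists>P. \<forall>\<kappa><d. poly (P \<kappa>) 0 = y0 \<kappa> \<and>
    (\<lambda>h. poly (pderiv (P \<kappa>)) h - (\<Sum>\<sigma>\<in>S. f \<sigma> (t0 + h) (poly_path d P h) \<kappa>)) \<in> O[nhds 0](\<lambda>h. h ^ k)"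
  using \<open>k \<le> Suc m\<close>
proof (induction k)
  case 0
  define P where "P = (\<lambda>\<kappa>. [:y0 \<kappa>:])"
  have "(\<lambda>h. f \<sigma> (t0 + h) (poly_path d P h) \<kappa>) \<in> O[nhds 0](\<lambda>_. 1)" if "\<sigma> \<in> S" "\<kappa> < d" for \<sigma> \<kappa>
  proof (rule bigoI_tendsto[where c = "f \<sigma> (t0 + 0) (poly_path d P 0) \<kappa>"])
    show "((\<lambda>h. f \<sigma> (t0 + h) (poly_path d P h) \<kappa> / 1) \<longlongrightarrow> f \<sigma> (t0 + 0) (poly_path d P 0) \<kappa>) (nhds 0)"
      unfolding div_by_1
      by (intro continuous_rhs_tendsto[OF Ck_continuous[OF smooth_rhs_Ck[OF smooth]]] that
            tendsto_intros poly_path_tendsto filterlim_ident)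
  qed auto
  then have "(\<lambda>h. poly (pderiv (P \<kappa>)) h - (\<Sum>\<sigma>\<in>S. f \<sigma> (t0 + h) (poly_path d P h) \<kappa>)) \<in> O[nhds 0](\<lambda>_. 1)"
    if "\<kappa> < d" for \<kappa>
    using that by (intro sum_in_bigo big_sum_in_bigo) (auto simp: P_def)
  then show ?case
    by (intro exI[of _ P]) (auto simp: P_def)
next
  case (Suc k)
  then obtain P where P0: "\<And>\<kappa>. \<kappa> < d \<Longrightarrow> poly (P \<kappa>) 0 = y0 \<kappa>" and
    P: "\<And>\<kappa>. \<kappa> < d \<Longrightarrow> (\<lambda>h. poly (pderiv (P \<kappa>)) h - (\<Sum>\<sigma>\<in>S. f \<sigma> (t0 + h) (poly_path d P h) \<kappa>))
      \<in> O[nhds 0](\<lambda>h. h ^ k)"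
    by (meson Suc_leD)
  have "\<exists>q. \<forall>\<kappa>. \<kappa> < d \<longrightarrow> (\<lambda>h. (\<Sum>\<sigma>\<in>S. f \<sigma> (t0 + h) (poly_path d P h) \<kappa>) - poly (q \<kappa>) h)
      \<in> O[nhds 0](\<lambda>h. h ^ Suc k)"
  proof (intro choice allI)
    fix \<kappa>
    show "\<exists>q. \<kappa> < d \<longrightarrow> (\<lambda>h. (\<Sum>\<sigma>\<in>S. f \<sigma> (t0 + h) (poly_path d P h) \<kappa>) - poly q h)
      \<in> O[nhds 0](\<lambda>h. h ^ Suc k)"
    proof (cases "\<kappa> < d")
      case True
      have "\<exists>q. \<forall>\<sigma>. \<sigma> \<in> S \<longrightarrow>
          (\<lambda>h. f \<sigma> (t0 + h) (poly_path d P h) \<kappa> - poly (q \<sigma>) h) \<in> O[nhds 0](\<lambda>h. h ^ Suc m)"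
        by (intro choice) (use Ck_taylor[OF smooth_rhs_Ck[OF smooth True]] in blast)
      then obtain q where
        "\<And>\<sigma>. \<sigma> \<in> S \<Longrightarrow> (\<lambda>h. f \<sigma> (t0 + h) (poly_path d P h) \<kappa> - poly (q \<sigma>) h) \<in> O[nhds 0](\<lambda>h. h ^ Suc m)"
        by blast
      then have "(\<lambda>h. \<Sum>\<sigma>\<in>S. f \<sigma> (t0 + h) (poly_path d P h) \<kappa> - poly (q \<sigma>) h) \<in> O[nhds 0](\<lambda>h. h ^ Suc k)"
        by (intro big_sum_in_bigo bigo_power_le[OF _ order_refl Suc.prems])
      then show ?thesis
        by (intro exI[of _ "\<Sum>\<sigma>\<in>S. q \<sigma>"]) (simp add: poly_sum sum_subtractf)
    qed auto
  qed
  then obtain q where q: "\<And>\<kappa>. \<kappa> < d \<Longrightarrow>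
      (\<lambda>h. (\<Sum>\<sigma>\<in>S. f \<sigma> (t0 + h) (poly_path d P h) \<kappa>) - poly (q \<kappa>) h) \<in> O[nhds 0](\<lambda>h. h ^ Suc k)"
    by blast
  have "\<exists>Q. \<forall>\<kappa>. pderiv (Q \<kappa>) = q \<kappa> \<and> poly (Q \<kappa>) 0 = y0 \<kappa>"
    by (intro choice allI poly_antiderivative)
  then obtain Q where Q: "\<And>\<kappa>. pderiv (Q \<kappa>) = q \<kappa>" "\<And>\<kappa>. poly (Q \<kappa>) 0 = y0 \<kappa>"
    by blast
  \<comment> \<open>The derivatives of \<open>Q\<close> and \<open>P\<close> differ by the residual
    of \<open>P\<close> up to higher order, and the initial values agree. This gain of one power is
    passed to the residual of \<open>Q\<close> by the Lipschitz estimate.\<close>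
  have QP: "(\<lambda>h. poly (Q \<kappa>) h - poly (P \<kappa>) h) \<in> O[nhds 0](\<lambda>h. h ^ Suc k)" if "\<kappa> < d" for \<kappa>
  proof -
    have "(\<lambda>h. poly (q \<kappa>) h - poly (pderiv (P \<kappa>)) h) \<in> O[nhds 0](\<lambda>h. h ^ k)"
      using sum_in_bigo(1)[OF bigo_power_le[OF q[OF that]] P[OF that]]
      by (subst landau_o.big.uminus_in_iff[symmetric]) simp
    then have "(\<lambda>h. poly (Q \<kappa>) h - poly (P \<kappa>) h - (poly (Q \<kappa>) 0 - poly (P \<kappa>) 0))
        \<in> O[nhds 0](\<lambda>h. h ^ Suc k)"
      by (rule bigo_integrate_nhds[rotated]) (auto intro!: derivative_eq_intros poly_DERIV simp: Q)
    then show ?thesis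
      by (simp add: Q P0 that)
  qed
  define E where "E = (\<lambda>h \<kappa>. if \<kappa> < d then poly (Q \<kappa>) h - poly (P \<kappa>) h else 0)"
  have pathQ: "poly_path d Q h = (\<lambda>\<kappa>. poly_path d P h \<kappa> + E h \<kappa>)" for h
    by (auto simp: poly_path_def E_def)
  have "(\<lambda>h. f \<sigma> (t0 + h) (poly_path d Q h) \<kappa> - f \<sigma> (t0 + h) (poly_path d P h) \<kappa>) \<in> O[nhds 0](\<lambda>h. h ^ Suc k)"
    if "\<sigma> \<in> S" "\<kappa> < d" for \<sigma> \<kappa>
    unfolding pathQ
  proof (rule Ck_lipschitz[OF smooth_rhs_Ck[OF smooth[OF that(1)] that(2)], where p = "poly_path d P 0"])
    show "((\<lambda>h. t0 + h) \<longlongrightarrow> t0 + 0) (nhds 0)"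
      by (intro tendsto_intros filterlim_ident)
    show "((\<lambda>h. poly_path d P h \<kappa>) \<longlongrightarrow> poly_path d P 0 \<kappa>) (nhds 0)" for \<kappa>
      by (intro poly_path_tendsto filterlim_ident)
    show "((\<lambda>h. E h \<kappa>) \<longlongrightarrow> 0) (nhds 0)" if "\<kappa> < d" for \<kappa>
    proof -
      have "((\<lambda>h. poly (Q \<kappa>) h - poly (P \<kappa>) h) \<longlongrightarrow> poly (Q \<kappa>) 0 - poly (P \<kappa>) 0) (nhds 0)"
        by (intro tendsto_intros tendsto_poly filterlim_ident)
      then show ?thesis
        by (simp add: E_def that Q P0)
    qed
    show "(\<lambda>h. E h \<kappa>) \<in> O[nhds 0](\<lambda>h. h ^ Suc k)" if "\<kappa> < d" for \<kappa>
      using QP[OF that] that by (simp add: E_def)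
  qed (simp add: E_def)
  then have "(\<lambda>h. \<Sum>\<sigma>\<in>S. f \<sigma> (t0 + h) (poly_path d Q h) \<kappa> - f \<sigma> (t0 + h) (poly_path d P h) \<kappa>)
      \<in> O[nhds 0](\<lambda>h. h ^ Suc k)" if "\<kappa> < d" for \<kappa>
    using that by (intro big_sum_in_bigo)
  note diff = this
  have "(\<lambda>h. poly (q \<kappa>) h - (\<Sum>\<sigma>\<in>S. f \<sigma> (t0 + h) (poly_path d Q h) \<kappa>)) \<in> O[nhds 0](\<lambda>h. h ^ Suc k)"
    if "\<kappa> < d" for \<kappa>
    using sum_in_bigo(1)[OF diff[OF that] q[OF that]]
    by (subst landau_o.big.uminus_in_iff[symmetric]) (simp add: sum_subtractf)
  then show ?case
    using Q by (intro exI[of _ Q]) simp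
qed

text \<open>A bootstrap takes the place of Gronwall's inequality: if the difference is O(h^j), so is
  its derivative by the Lipschitz estimate, and integration gives O(h^(j+1)). It ends at
  \<open>k + 1\<close> because the residual of \<open>P\<close> is O(h^k).\<close>

lemma exact_solution_poly:
  assumes smooth: "\<And>\<sigma>. \<sigma> \<in> S \<Longrightarrow> smooth_rhs d (Suc m) (f \<sigma>)"
    and exact: "exact_solution d S f t0 T y" and "T > 0"
    and P0: "\<And>\<kappa>. \<kappa> < d \<Longrightarrow> poly (P \<kappa>) 0 = y t0 \<kappa>"
    and P: "\<And>\<kappa>. \<kappa> < d \<Longrightarrow> (\<lambda>h. poly (pderiv (P \<kappa>)) h - (\<Sum>\<sigma>\<in>S. f \<sigma> (t0 + h) (poly_path d P h) \<kappa>))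
      \<in> O[nhds 0](\<lambda>h. h ^ k)"
    and "\<kappa> < d"
  shows "(\<lambda>h. y (t0 + h) \<kappa> - poly (P \<kappa>) h) \<in> O[at_right 0](\<lambda>h. h ^ Suc k)"
proof -
  \<comment> \<open>This filter keeps the point 0, since the integration lemma bounds the derivative
    on a closed segment starting there; \<open>E 0 = 0\<close> justifies the change from the
    punctured filter.\<close>
  define F where "F = inf (nhds 0) (principal {0..T})"
  have F_le: "F \<le> nhds 0" "at_right 0 \<le> F"
    unfolding at_within_Icc_at_right[OF \<open>T > 0\<close>, symmetric]
    by (auto simp: F_def at_within_def intro: le_infI2)
  have ident: "filterlim (\<lambda>h. h) (nhds 0) F"
    using F_le(1) by (simp add: filterlim_def)
  define E where "E = (\<lambda>h \<kappa>. if \<kappa> < d then y (t0 + h) \<kappa> - poly (P \<kappa>) h else 0)"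
  have yE: "trunc d (y (t0 + h)) = (\<lambda>\<kappa>. poly_path d P h \<kappa> + E h \<kappa>)" for h
    by (auto simp: poly_path_def E_def trunc_def)
  have E_der: "((\<lambda>h. E h \<kappa>) has_real_derivative
      (\<Sum>\<sigma>\<in>S. f \<sigma> (t0 + h) (y (t0 + h)) \<kappa>) - poly (pderiv (P \<kappa>)) h) (at h within {0..T})"
    if "h \<in> {0..T}" "\<kappa> < d" for h \<kappa>
  proof -
    have img: "(+) t0 ` {0..T} = {t0..t0 + T}"
      by simp
    have "((\<lambda>t. y t \<kappa>) has_real_derivative (\<Sum>\<sigma>\<in>S. f \<sigma> (t0 + h) (y (t0 + h)) \<kappa>))
        (at (t0 + h) within (+) t0 ` {0..T})"
      unfolding img using exact that unfolding exact_solution_def by simp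
    moreover have "((+) t0 has_real_derivative 1) (at h within {0..T})"
      by (auto intro!: derivative_eq_intros)
    ultimately have "((\<lambda>h. y (t0 + h) \<kappa>) has_real_derivative (\<Sum>\<sigma>\<in>S. f \<sigma> (t0 + h) (y (t0 + h)) \<kappa>))
        (at h within {0..T})"
      using DERIV_image_chain by (fastforce simp: o_def)
    from DERIV_diff[OF this has_field_derivative_at_within[OF poly_DERIV]] that show ?thesis
      by (simp add: E_def)
  qed
  have E_0: "E 0 \<kappa> = 0" for \<kappa>
    by (simp add: E_def P0)
  have E_lim: "((\<lambda>h. E h \<kappa>) \<longlongrightarrow> 0) F" if "\<kappa> < d" for \<kappa>
  proof -
    have "((\<lambda>h. E h \<kappa>) \<longlongrightarrow> 0) (at 0 within {0..T})"
      using DERIV_continuous[OF E_der[OF _ that, of 0]] \<open>T > 0\<close> by (simp add: continuous_within E_0)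
    then show ?thesis
      unfolding F_def tendsto_def eventually_at_filter eventually_inf_principal
      by (auto elim!: eventually_mono simp: E_0)
  qed
  have "(\<lambda>h. E h \<kappa>) \<in> O[F](\<lambda>h. h ^ j)" if "\<kappa> < d" "j \<le> Suc k" for j \<kappa>
    using that
  proof (induction j arbitrary: \<kappa>)
    case 0
    then show ?case
      using E_lim[of \<kappa>] by (intro bigoI_tendsto[where c = 0]) auto
  next
    case (Suc j)
    have "(\<lambda>h. f \<sigma> (t0 + h) (y (t0 + h)) \<kappa> - f \<sigma> (t0 + h) (poly_path d P h) \<kappa>) \<in> O[F](\<lambda>h. h ^ j)"
      if "\<sigma> \<in> S" for \<sigma>
      unfolding smooth_rhs_trunc[OF smooth[OF that] Suc.prems(1), of _ "y _"] yE
    proof (rule Ck_lipschitz[OF smooth_rhs_Ck[OF smooth[OF that] Suc.prems(1)], where p = "poly_path d P 0"])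
      show "((\<lambda>h. t0 + h) \<longlongrightarrow> t0 + 0) F"
        by (intro tendsto_intros ident)
      show "((\<lambda>h. poly_path d P h \<kappa>) \<longlongrightarrow> poly_path d P 0 \<kappa>) F" for \<kappa>
        by (intro poly_path_tendsto ident)
      show "(\<lambda>h. E h \<kappa>) \<in> O[F](\<lambda>h. h ^ j)" if "\<kappa> < d" for \<kappa>
        using Suc.IH[OF that] Suc.prems(2) by simp
    qed (use E_lim in \<open>auto simp: E_def\<close>)
    then have "(\<lambda>h. \<Sum>\<sigma>\<in>S. f \<sigma> (t0 + h) (y (t0 + h)) \<kappa> - f \<sigma> (t0 + h) (poly_path d P h) \<kappa>) \<in> O[F](\<lambda>h. h ^ j)"
      by (intro big_sum_in_bigo)
    moreover have "(\<lambda>h. poly (pderiv (P \<kappa>)) h - (\<Sum>\<sigma>\<in>S. f \<sigma> (t0 + h) (poly_path d P h) \<kappa>)) \<in> O[F](\<lambda>h. h ^ j)"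
      using bigo_power_le[OF landau_o.big.filter_mono[OF F_le(1) P[OF Suc.prems(1)]] F_le(1)] Suc.prems(2)
      by simp
    ultimately have "(\<lambda>h. (\<Sum>\<sigma>\<in>S. f \<sigma> (t0 + h) (y (t0 + h)) \<kappa>) - poly (pderiv (P \<kappa>)) h) \<in> O[F](\<lambda>h. h ^ j)"
      using sum_in_bigo(2) by (fastforce simp: sum_subtractf)
    then have "(\<lambda>h. E h \<kappa> - E 0 \<kappa>) \<in> O[F](\<lambda>h. h ^ Suc j)"
      unfolding F_def
    proof (rule bigo_integrate[rotated 2])
      show "closed_segment 0 h \<subseteq> {0..T}" if "h \<in> {0..T}" for h
        using that by (auto simp: closed_segment_eq_real_ivl)
    qed (use E_der Suc.prems in auto)
    then show ?case
      by (simp add: E_0)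
  qed
  from landau_o.big.filter_mono[OF F_le(2) this[OF \<open>\<kappa> < d\<close> order_refl]] \<open>\<kappa> < d\<close> show ?thesis
    by (simp add: E_def)
qed


section \<open>Order four of additive methods\<close>

lemma bigo_cmult: "f \<in> O[F](g) \<Longrightarrow> (\<lambda>v. (a :: real) * f v) \<in> O[F](g)"
  by (cases "a = 0") auto

lemma bigo_mult_power:
  fixes f g :: "real \<Rightarrow> real"
  assumes "f \<in> O[F](\<lambda>h. h ^ i)" "g \<in> O[F](\<lambda>h. h ^ j)" "F \<le> nhds 0" "k \<le> i + j"
  shows "(\<lambda>h. f h * g h) \<in> O[F](\<lambda>h. h ^ k)"
  by (rule bigo_power_le[where k = "i + j"])
     (use landau_o.big.mult[OF assms(1,2)] assms(3,4) in \<open>simp_all add: power_add\<close>)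

text \<open>The factor \<open>a\<close> will be an abscissa, possibly zero or negative; this is why
  the expansions are stated for the full neighbourhood filter of 0.\<close>

lemma bigo_scale:
  fixes \<phi> :: "real \<Rightarrow> real"
  assumes "\<phi> \<in> O[nhds 0](\<lambda>h. h ^ k)"
  shows "(\<lambda>H. \<phi> (a * H)) \<in> O[at_right 0](\<lambda>H. H ^ k)"
proof -
  have "((\<lambda>H. a * H) \<longlongrightarrow> a * 0) (at_right 0)"
    by (intro tendsto_intros)
  from landau_o.big.compose[OF assms this[unfolded mult_zero_right]]
  have "(\<lambda>H. \<phi> (a * H)) \<in> O[at_right 0](\<lambda>H. (a * H) ^ k)" .
  then show ?thesis
    by (rule landau_o.big_trans) (simp add: power_mult_distrib bigo_cmult)
qed

lemma poly_taylor: "(\<lambda>h. poly q h - (\<Sum>k<m. coeff q k * h ^ k)) \<in> O[nhds 0](\<lambda>h :: real. h ^ m)"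
proof (induction m arbitrary: q)
  case 0
  then show ?case
    using poly_bigo_1[of "nhds 0" q] by simp
next
  case (Suc m)
  obtain a r where q: "q = pCons a r"
    by (cases q)
  have "(\<lambda>h. h * (poly r h - (\<Sum>k<m. coeff r k * h ^ k))) \<in> O[nhds 0](\<lambda>h. h * h ^ m)"
    by (intro landau_o.big.mult Suc.IH landau_o.big_refl)
  moreover have "h * (poly r h - (\<Sum>k<m. coeff r k * h ^ k)) = poly q h - (\<Sum>k<Suc m. coeff q k * h ^ k)" for h
    unfolding sum.lessThan_Suc_shift
    by (simp add: q right_diff_distrib sum_distrib_left mult_ac)
  ultimately show ?case
    by simp
qed

lemma Ck_taylor_coeffs:
  assumes "Ck d m g"
  shows "\<exists>a. (\<lambda>h. g (t0 + h) (poly_path d P h) - (\<Sum>k<m. a k * h ^ k)) \<in> O[nhds 0](\<lambda>h. h ^ m)"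
proof -
  obtain q where "(\<lambda>h. g (t0 + h) (poly_path d P h) - poly q h) \<in> O[nhds 0](\<lambda>h. h ^ m)"
    using Ck_taylor[OF assms] by blast
  from sum_in_bigo(1)[OF this poly_taylor[of q m]] show ?thesis
    by (intro exI[of _ "coeff q"]) simp
qed

lemma DERIV_power_Suc_div: "((\<lambda>h :: real. h ^ Suc k / real (Suc k)) has_real_derivative h ^ k) (at h)"
  using DERIV_cdivide[OF DERIV_pow[of "Suc k" h], of "real (Suc k)"] by (simp del: of_nat_Suc)

lemma sum_weight_linear:
  fixes A :: "'a \<Rightarrow> real"
  assumes "\<And>\<nu>. \<nu> \<in> S \<Longrightarrow> (\<Sum>q\<in>R. A q * (w q * D \<nu> q)) = 0"
  shows "(\<Sum>q\<in>R. A q * (w q * (\<Sum>\<nu>\<in>S. x \<nu> * D \<nu> q))) = 0"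
proof -
  have "(\<Sum>q\<in>R. A q * (w q * (\<Sum>\<nu>\<in>S. x \<nu> * D \<nu> q))) = (\<Sum>\<nu>\<in>S. x \<nu> * (\<Sum>q\<in>R. A q * (w q * D \<nu> q)))"
    by (subst sum.swap[of _ R S] | simp add: sum_distrib_left mult_ac)+
  then show ?thesis
    using assms by simp
qed

text \<open>The error of row \<open>r\<close> of tableau \<open>\<sigma>\<close> as a quadrature
  rule for t^k on the interval from 0 to \<open>c r\<close>. Its vanishing in all rows is the
  equation with index k + 1 of the classical simplifying assumption C.\<close>

definition stage_defect ::
  "'r set \<Rightarrow> (part \<Rightarrow> 'r \<Rightarrow> 'r \<Rightarrow> real) \<Rightarrow> ('r \<Rightarrow> real) \<Rightarrow> nat \<Rightarrow> part \<Rightarrow> 'r \<Rightarrow> real" where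
  "stage_defect R A c k \<sigma> r = (\<Sum>q\<in>R. A \<sigma> r q * c q ^ k) - c r ^ Suc k / real (Suc k)"

text \<open>Stages may lie to the left of \<open>t0\<close>, where \<open>y\<close> is not given, so they are compared with a
  polynomial that solves the equation up to \<open>O(h\<^sup>4)\<close> on both sides of \<open>t0\<close>.\<close>

theorem additive_order_4:
  fixes R :: "'r set" and A :: "part \<Rightarrow> 'r \<Rightarrow> 'r \<Rightarrow> real" and c :: "'r \<Rightarrow> real"
    and Y :: "real \<Rightarrow> 'r \<Rightarrow> state"
  defines "D \<equiv> stage_defect R A c"
  assumes "l \<in> R" and c_last: "c l = 1"
    and rows: "\<And>\<sigma> r. \<sigma> \<in> S \<Longrightarrow> r \<in> R \<Longrightarrow> (\<Sum>q\<in>R. A \<sigma> r q) = c r"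
    and quad: "\<And>\<sigma> k. \<sigma> \<in> S \<Longrightarrow> k < 4 \<Longrightarrow> (\<Sum>q\<in>R. A \<sigma> l q * c q ^ k) = 1 / real (Suc k)"
    and cond_1: "\<And>\<sigma> \<nu>. \<sigma> \<in> S \<Longrightarrow> \<nu> \<in> S \<Longrightarrow> (\<Sum>q\<in>R. A \<sigma> l q * D 1 \<nu> q) = 0"
    and cond_c1: "\<And>\<sigma> \<nu>. \<sigma> \<in> S \<Longrightarrow> \<nu> \<in> S \<Longrightarrow> (\<Sum>q\<in>R. A \<sigma> l q * (c q * D 1 \<nu> q)) = 0"
    and cond_2: "\<And>\<sigma> \<nu>. \<sigma> \<in> S \<Longrightarrow> \<nu> \<in> S \<Longrightarrow> (\<Sum>q\<in>R. A \<sigma> l q * D 2 \<nu> q) = 0"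
    and cond_A1: "\<And>\<sigma> \<nu> \<mu>. \<sigma> \<in> S \<Longrightarrow> \<nu> \<in> S \<Longrightarrow> \<mu> \<in> S \<Longrightarrow>
      (\<Sum>q\<in>R. A \<sigma> l q * (\<Sum>p\<in>R. A \<nu> q p * D 1 \<mu> p)) = 0"
    and smooth: "\<And>\<sigma>. \<sigma> \<in> S \<Longrightarrow> smooth_rhs d 4 (f \<sigma>)"
    and exact: "exact_solution d S f t0 T y" "T > 0"
    and stages: "\<forall>\<^sub>F H in at_right 0. \<forall>r\<in>R. \<forall>\<kappa><d. Y H r \<kappa> = y t0 \<kappa> +
      H * (\<Sum>\<sigma>\<in>S. \<Sum>q\<in>R. A \<sigma> r q * f \<sigma> (t0 + c q * H) (Y H q) \<kappa>)"
    and lim: "\<And>r \<kappa>. r \<in> R \<Longrightarrow> \<kappa> < d \<Longrightarrow> ((\<lambda>H. Y H r \<kappa>) \<longlongrightarrow> y t0 \<kappa>) (at_right 0)"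
    and "\<kappa> < d"
  shows "(\<lambda>H. Y H l \<kappa> - y (t0 + H) \<kappa>) \<in> O[at_right 0](\<lambda>H. H ^ 5)"
proof -
  note D_def = assms(1) stage_defect_def
  let ?O = "\<lambda>k. O[at_right (0 :: real)](\<lambda>H. H ^ k)"
  have nhds: "at_right 0 \<le> nhds (0 :: real)"
    by (simp add: at_within_def)
  have scale_lim: "((\<lambda>H. a * H) \<longlongrightarrow> 0) (at_right 0)" for a :: real
    by (auto intro!: tendsto_eq_intros)
  have pow: "(\<lambda>H. H ^ k :: real) \<in> ?O j" if "j \<le> k" for j k
    using bigo_power_le[OF landau_o.big_refl nhds that] .
  note bigo_mono = bigo_power_le[OF _ nhds]
  note Ck_4 = smooth_rhs_Ck[OF smooth]
  obtain P where P0: "\<And>\<kappa>. \<kappa> < d \<Longrightarrow> poly (P \<kappa>) 0 = y t0 \<kappa>" and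
    P: "\<And>\<kappa>. \<kappa> < d \<Longrightarrow> (\<lambda>h. poly (pderiv (P \<kappa>)) h - (\<Sum>\<sigma>\<in>S. f \<sigma> (t0 + h) (poly_path d P h) \<kappa>))
      \<in> O[nhds 0](\<lambda>h. h ^ 4)"
    using picard_poly[of S d 3 f 4 "y t0" t0] smooth by auto
  have yP: "(\<lambda>H. y (t0 + H) \<kappa> - poly (P \<kappa>) H) \<in> ?O 5" if "\<kappa> < d" for \<kappa>
    using exact_solution_poly[of S d 3 f t0 T y P 4 \<kappa>] smooth exact P0 P that by simp

  \<comment> \<open>The parts are expanded separately because each is weighted by its own tableau;
    only their sum is tied to the derivative of \<open>P\<close>.\<close>
  define F where "F \<sigma> \<kappa> h = f \<sigma> (t0 + h) (poly_path d P h) \<kappa>" for \<sigma> \<kappa> h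
  have "\<exists>a. \<forall>\<sigma> \<kappa>. \<sigma> \<in> S \<and> \<kappa> < d \<longrightarrow>
      (\<lambda>h. F \<sigma> \<kappa> h - (\<Sum>k<4. a \<sigma> \<kappa> k * h ^ k)) \<in> O[nhds 0](\<lambda>h. h ^ 4)"
    unfolding F_def by (intro choice allI) (use Ck_taylor_coeffs[OF Ck_4] in blast)
  then obtain a where a: "\<And>\<sigma> \<kappa>. \<sigma> \<in> S \<Longrightarrow> \<kappa> < d \<Longrightarrow>
      (\<lambda>h. F \<sigma> \<kappa> h - (\<Sum>k<4. a \<sigma> \<kappa> k * h ^ k)) \<in> O[nhds 0](\<lambda>h. h ^ 4)"
    by blast
  have P_taylor: "(\<lambda>h. poly (P \<kappa>) h - y t0 \<kappa> - (\<Sum>\<sigma>\<in>S. \<Sum>k<4. a \<sigma> \<kappa> k * (h ^ Suc k / real (Suc k))))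
      \<in> O[nhds 0](\<lambda>h. h ^ 5)" if "\<kappa> < d" for \<kappa>
  proof -
    have "(\<lambda>h. \<Sum>\<sigma>\<in>S. F \<sigma> \<kappa> h - (\<Sum>k<4. a \<sigma> \<kappa> k * h ^ k)) \<in> O[nhds 0](\<lambda>h. h ^ 4)"
      by (intro big_sum_in_bigo a that)
    from sum_in_bigo(1)[OF P[OF that] this]
    have "(\<lambda>h. poly (pderiv (P \<kappa>)) h - (\<Sum>\<sigma>\<in>S. \<Sum>k<4. a \<sigma> \<kappa> k * h ^ k)) \<in> O[nhds 0](\<lambda>h. h ^ 4)"
      by (simp add: F_def sum_subtractf)
    then have "(\<lambda>h. (poly (P \<kappa>) h - (\<Sum>\<sigma>\<in>S. \<Sum>k<4. a \<sigma> \<kappa> k * (h ^ Suc k / real (Suc k)))) -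
        (poly (P \<kappa>) 0 - (\<Sum>\<sigma>\<in>S. \<Sum>k<4. a \<sigma> \<kappa> k * (0 ^ Suc k / real (Suc k))))) \<in> O[nhds 0](\<lambda>h. h ^ Suc 4)"
      by (rule bigo_integrate_nhds[rotated])
         (intro DERIV_diff poly_DERIV DERIV_sum DERIV_cmult DERIV_power_Suc_div)
    then show ?thesis
      using P0[OF that] by (simp add: algebra_simps del: of_nat_Suc)
  qed

  \<comment> \<open>The spatial partials enter the error recursion and are chosen uniformly in all
    indices; the time derivative serves only the linearisation and stays existential.\<close>
  have "\<exists>gx. \<forall>\<sigma> \<kappa>. \<sigma> \<in> S \<and> \<kappa> < d \<longrightarrow> (\<exists>gt.
    (\<forall>t x. ((\<lambda>s. f \<sigma> s x \<kappa>) has_real_derivative gt t x) (at t)) \<and> Ck d 3 gt \<and>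
    (\<forall>\<mu><d. (\<forall>t x. ((\<lambda>s. f \<sigma> t (x(\<mu> := s)) \<kappa>) has_real_derivative gx \<sigma> \<kappa> \<mu> t x) (at (x \<mu>))) \<and>
      Ck d 3 (gx \<sigma> \<kappa> \<mu>)))"
  proof (intro choice allI)
    fix \<sigma> \<kappa>
    show "\<exists>gx. \<sigma> \<in> S \<and> \<kappa> < d \<longrightarrow> (\<exists>gt.
      (\<forall>t x. ((\<lambda>s. f \<sigma> s x \<kappa>) has_real_derivative gt t x) (at t)) \<and> Ck d 3 gt \<and>
      (\<forall>\<mu><d. (\<forall>t x. ((\<lambda>s. f \<sigma> t (x(\<mu> := s)) \<kappa>) has_real_derivative gx \<mu> t x) (at (x \<mu>))) \<and> Ck d 3 (gx \<mu>)))"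
    proof (cases "\<sigma> \<in> S \<and> \<kappa> < d")
      case True
      then have "Ck d (Suc 3) (\<lambda>t x. f \<sigma> t x \<kappa>)"
        using Ck_4 by simp
      then show ?thesis
        by (rule Ck_SucE) blast
    qed auto
  qed
  then obtain gx where gx: "\<And>\<sigma> \<kappa>. \<sigma> \<in> S \<Longrightarrow> \<kappa> < d \<Longrightarrow> \<exists>gt.
    (\<forall>t x. ((\<lambda>s. f \<sigma> s x \<kappa>) has_real_derivative gt t x) (at t)) \<and> Ck d 3 gt \<and>
    (\<forall>\<mu><d. (\<forall>t x. ((\<lambda>s. f \<sigma> t (x(\<mu> := s)) \<kappa>) has_real_derivative gx \<sigma> \<kappa> \<mu> t x) (at (x \<mu>))) \<and>
      Ck d 3 (gx \<sigma> \<kappa> \<mu>))"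
    by blast
  define J where "J \<sigma> \<kappa> \<mu> h = gx \<sigma> \<kappa> \<mu> (t0 + h) (poly_path d P h)" for \<sigma> \<kappa> \<mu> h
  have "\<exists>j. \<forall>\<sigma> \<kappa> \<mu>. \<sigma> \<in> S \<and> \<kappa> < d \<and> \<mu> < d \<longrightarrow>
      (\<lambda>h. J \<sigma> \<kappa> \<mu> h - (\<Sum>k<3. j \<sigma> \<kappa> \<mu> k * h ^ k)) \<in> O[nhds 0](\<lambda>h. h ^ 3)"
    unfolding J_def by (intro choice allI) (use Ck_taylor_coeffs gx in meson)
  then obtain j where j: "\<And>\<sigma> \<kappa> \<mu>. \<sigma> \<in> S \<Longrightarrow> \<kappa> < d \<Longrightarrow> \<mu> < d \<Longrightarrow>
      (\<lambda>h. J \<sigma> \<kappa> \<mu> h - (\<Sum>k<3. j \<sigma> \<kappa> \<mu> k * h ^ k)) \<in> O[nhds 0](\<lambda>h. h ^ 3)"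
    by blast
  define j0 where "j0 \<sigma> \<kappa> \<mu> = j \<sigma> \<kappa> \<mu> 0" for \<sigma> \<kappa> \<mu>
  define j1 where "j1 \<sigma> \<kappa> \<mu> = j \<sigma> \<kappa> \<mu> 1" for \<sigma> \<kappa> \<mu>
  \<comment> \<open>The Jacobian is needed up to its linear term only: it multiplies stage errors
    O(H^2), and the recursion supplies a further factor \<open>H\<close>, so its quadratic part acts
    at O(H^5).\<close>
  have J2: "(\<lambda>H. J \<sigma> \<kappa> \<mu> (b * H) - j0 \<sigma> \<kappa> \<mu> - j1 \<sigma> \<kappa> \<mu> * (b * H)) \<in> ?O 2"
    if "\<sigma> \<in> S" "\<kappa> < d" "\<mu> < d" for \<sigma> \<kappa> \<mu> b
  proof -
    have "(\<lambda>H. J \<sigma> \<kappa> \<mu> (b * H) - (\<Sum>k<3. j \<sigma> \<kappa> \<mu> k * (b * H) ^ k)) \<in> ?O 2"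
      using bigo_mono[OF bigo_scale[OF j[OF that]]] by simp
    moreover have "(\<lambda>H. (j \<sigma> \<kappa> \<mu> 2 * b ^ 2) * H ^ 2) \<in> ?O 2"
      by (intro bigo_cmult landau_o.big_refl)
    ultimately have "(\<lambda>H. J \<sigma> \<kappa> \<mu> (b * H) - (\<Sum>k<3. j \<sigma> \<kappa> \<mu> k * (b * H) ^ k) + (j \<sigma> \<kappa> \<mu> 2 * b ^ 2) * H ^ 2) \<in> ?O 2"
      by (rule sum_in_bigo(1))
    then show ?thesis
      by (simp add: j0_def j1_def eval_nat_numeral algebra_simps)
  qed
  have J1: "(\<lambda>H. J \<sigma> \<kappa> \<mu> (b * H) - j0 \<sigma> \<kappa> \<mu>) \<in> ?O 1" if "\<sigma> \<in> S" "\<kappa> < d" "\<mu> < d" for \<sigma> \<kappa> \<mu> b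
  proof -
    have "(\<lambda>H. (j1 \<sigma> \<kappa> \<mu> * b) * H ^ 1) \<in> ?O 1"
      by (intro bigo_cmult landau_o.big_refl)
    from sum_in_bigo(1)[OF bigo_mono[OF J2[OF that, of b]] this] show ?thesis
      by (simp add: mult.assoc)
  qed
  have J0: "(\<lambda>H. J \<sigma> \<kappa> \<mu> (b * H)) \<in> ?O 0" if "\<sigma> \<in> S" "\<kappa> < d" "\<mu> < d" for \<sigma> \<kappa> \<mu> b
    using sum_in_bigo(1)[OF bigo_mono[OF J1[OF that, of b], of 0], of "\<lambda>_. j0 \<sigma> \<kappa> \<mu>"] by simp

  define E where "E r \<kappa> H = (if \<kappa> < d then Y H r \<kappa> - poly (P \<kappa>) (c r * H) else 0)" for r \<kappa> H
  have E_out: "E r \<kappa> H = 0" if "d \<le> \<kappa>" for r \<kappa> H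
    using that by (simp add: E_def)
  have YE: "trunc d (Y H r) = (\<lambda>\<kappa>. poly_path d P (c r * H) \<kappa> + E r \<kappa> H)" for H r
    by (auto simp: trunc_def poly_path_def E_def)
  have E_lim: "((\<lambda>H. E r \<kappa> H) \<longlongrightarrow> 0) (at_right 0)" if "r \<in> R" for r \<kappa>
  proof (cases "\<kappa> < d")
    case True
    have "((\<lambda>H. Y H r \<kappa> - poly (P \<kappa>) (c r * H)) \<longlongrightarrow> y t0 \<kappa> - poly (P \<kappa>) 0) (at_right 0)"
      by (intro tendsto_diff lim that True tendsto_poly scale_lim)
    then show ?thesis
      using True by (simp add: E_def P0)
  qed (simp add: E_def)

  define lin where "lin \<sigma> r \<kappa> H = f \<sigma> (t0 + c r * H) (Y H r) \<kappa> - F \<sigma> \<kappa> (c r * H)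
      - (\<Sum>\<mu><d. J \<sigma> \<kappa> \<mu> (c r * H) * E r \<mu> H)" for \<sigma> r \<kappa> H
  have lin: "lin \<sigma> r \<kappa> \<in> ?O (2 * i)"
    if E: "\<And>\<mu>. \<mu> < d \<Longrightarrow> E r \<mu> \<in> ?O i" and "\<sigma> \<in> S" "r \<in> R" "\<kappa> < d" for \<sigma> r \<kappa> i
  proof -
    obtain gt where gt: "\<And>t x. ((\<lambda>s. f \<sigma> s x \<kappa>) has_real_derivative gt t x) (at t)" "Ck d 3 gt"
      "\<And>\<mu> t x. \<mu> < d \<Longrightarrow> ((\<lambda>s. f \<sigma> t (x(\<mu> := s)) \<kappa>) has_real_derivative gx \<sigma> \<kappa> \<mu> t x) (at (x \<mu>))"
      "\<And>\<mu>. \<mu> < d \<Longrightarrow> Ck d 3 (gx \<sigma> \<kappa> \<mu>)"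
      using gx[OF \<open>\<sigma> \<in> S\<close> \<open>\<kappa> < d\<close>] by blast
    have t_lim: "((\<lambda>H. t0 + c r * H) \<longlongrightarrow> t0 + 0) (at_right 0)"
      by (intro tendsto_intros scale_lim)
    have "(\<lambda>H. f \<sigma> (t0 + c r * H) (\<lambda>\<mu>. poly_path d P (c r * H) \<mu> + E r \<mu> H) \<kappa>
        - f \<sigma> (t0 + c r * H) (poly_path d P (c r * H)) \<kappa>
        - (\<Sum>\<mu><d. gx \<sigma> \<kappa> \<mu> (t0 + c r * H) (poly_path d P (c r * H)) * E r \<mu> H)) \<in> O[at_right 0](\<lambda>H. H ^ i * H ^ i)"
    proof (rule Ck_linearize[where g = "\<lambda>t x. f \<sigma> t x \<kappa>", OF gt(1) Ck_continuous[OF gt(2)] gt(3)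
          gt(4)[unfolded numeral_3_eq_3]])
      show "((\<lambda>H. t0 + c r * H) \<longlongrightarrow> t0 + 0) (at_right 0)"
        by (rule t_lim)
      show "((\<lambda>H. poly_path d P (c r * H) \<mu>) \<longlongrightarrow> poly_path d P 0 \<mu>) (at_right 0)" for \<mu>
        by (rule poly_path_tendsto[OF scale_lim])
    qed (use E E_lim[OF \<open>r \<in> R\<close>] E_out in auto)
    then show ?thesis
      unfolding lin_def smooth_rhs_trunc[OF smooth[OF \<open>\<sigma> \<in> S\<close>] \<open>\<kappa> < d\<close>, of _ "Y _ _"] YE
      by (simp add: F_def J_def mult_2 power_add)
  qed

  \<comment> \<open>\<open>main\<close> is what the Taylor terms of the comparison polynomial leave
    in the stage equation, \<open>JE\<close> the propagation of the other stage errors.\<close>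
  define main where "main r \<kappa> H = (\<Sum>\<sigma>\<in>S. \<Sum>k<4. a \<sigma> \<kappa> k * D k \<sigma> r * H ^ Suc k)" for r \<kappa> and H :: real
  define JE where "JE r \<kappa> H = (\<Sum>\<sigma>\<in>S. \<Sum>q\<in>R. A \<sigma> r q * (\<Sum>\<mu><d. J \<sigma> \<kappa> \<mu> (c q * H) * E q \<mu> H))" for r \<kappa> H
  \<comment> \<open>The bound \<open>2 * i + 1\<close> comes from the quadratic remainder of the
    linearisation times \<open>H\<close>, the bound 5 from the Taylor remainders.\<close>
  have master: "(\<lambda>H. E r \<kappa> H - main r \<kappa> H - H * JE r \<kappa> H) \<in> ?O m"
    if E: "\<And>r \<mu>. r \<in> R \<Longrightarrow> \<mu> < d \<Longrightarrow> E r \<mu> \<in> ?O i" and m: "m \<le> 2 * i + 1" "m \<le> 5"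
      and "r \<in> R" "\<kappa> < d" for r \<kappa> i m
  proof -
    let ?F = "\<lambda>\<sigma> h. F \<sigma> \<kappa> h - (\<Sum>k<4. a \<sigma> \<kappa> k * h ^ k)"
    let ?P = "\<lambda>h. poly (P \<kappa>) h - y t0 \<kappa> - (\<Sum>\<sigma>\<in>S. \<Sum>k<4. a \<sigma> \<kappa> k * (h ^ Suc k / real (Suc k)))"
    have main_eq: "main r \<kappa> H = H * (\<Sum>\<sigma>\<in>S. \<Sum>q\<in>R. A \<sigma> r q * (\<Sum>k<4. a \<sigma> \<kappa> k * (c q * H) ^ k))
        - (\<Sum>\<sigma>\<in>S. \<Sum>k<4. a \<sigma> \<kappa> k * ((c r * H) ^ Suc k / real (Suc k)))" for H
    proof -
      have "H * (\<Sum>q\<in>R. A \<sigma> r q * (\<Sum>k<4. a \<sigma> \<kappa> k * (c q * H) ^ k)) =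
          (\<Sum>k<4. a \<sigma> \<kappa> k * (\<Sum>q\<in>R. A \<sigma> r q * c q ^ k) * H ^ Suc k)" for \<sigma>
        unfolding sum_distrib_left sum_distrib_right
        by (subst sum.swap) (intro sum.cong refl; simp add: power_mult_distrib mult_ac)
      then show ?thesis
        by (simp add: main_def D_def sum_distrib_left[of H] right_diff_distrib left_diff_distrib
            sum_subtractf power_mult_distrib mult_ac del: of_nat_Suc power_Suc)
    qed
    have "(\<lambda>H. H ^ 1 * (\<Sum>\<sigma>\<in>S. \<Sum>q\<in>R. A \<sigma> r q * lin \<sigma> q \<kappa> H)) \<in> ?O m"
      by (rule bigo_mult_power[OF pow[OF order_refl] _ nhds, where j = "2 * i"])
         (use m in \<open>auto intro!: big_sum_in_bigo bigo_cmult lin E \<open>\<kappa> < d\<close>\<close>)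
    moreover have "(\<lambda>H. H ^ 1 * (\<Sum>\<sigma>\<in>S. \<Sum>q\<in>R. A \<sigma> r q * ?F \<sigma> (c q * H))) \<in> ?O m"
      by (rule bigo_mult_power[OF pow[OF order_refl] _ nhds, where j = 4])
         (use m in \<open>auto intro!: big_sum_in_bigo bigo_cmult bigo_scale[OF a] \<open>\<kappa> < d\<close>\<close>)
    moreover have "(\<lambda>H. ?P (c r * H)) \<in> ?O m"
      using bigo_mono[OF bigo_scale[OF P_taylor[OF \<open>\<kappa> < d\<close>]]] m by blast
    ultimately have rest: "(\<lambda>H. H ^ 1 * (\<Sum>\<sigma>\<in>S. \<Sum>q\<in>R. A \<sigma> r q * lin \<sigma> q \<kappa> H) +
        H ^ 1 * (\<Sum>\<sigma>\<in>S. \<Sum>q\<in>R. A \<sigma> r q * ?F \<sigma> (c q * H)) - ?P (c r * H)) \<in> ?O m"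
      by (rule sum_in_bigo(2)[OF sum_in_bigo(1)])
        have "\<forall>\<^sub>F H in at_right 0. E r \<kappa> H - main r \<kappa> H - H * JE r \<kappa> H =
        H ^ 1 * (\<Sum>\<sigma>\<in>S. \<Sum>q\<in>R. A \<sigma> r q * lin \<sigma> q \<kappa> H) +
        H ^ 1 * (\<Sum>\<sigma>\<in>S. \<Sum>q\<in>R. A \<sigma> r q * ?F \<sigma> (c q * H)) - ?P (c r * H)"
      using stages
    proof eventually_elim
      case (elim H)
      then have Y: "Y H r \<kappa> = y t0 \<kappa> + H * (\<Sum>\<sigma>\<in>S. \<Sum>q\<in>R. A \<sigma> r q * f \<sigma> (t0 + c q * H) (Y H q) \<kappa>)"
        using \<open>r \<in> R\<close> \<open>\<kappa> < d\<close> by blast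
      have "E r \<kappa> H = Y H r \<kappa> - poly (P \<kappa>) (c r * H)"
        using \<open>\<kappa> < d\<close> by (simp add: E_def)
      then show ?case
        unfolding main_eq JE_def lin_def Y
        by (simp only: right_diff_distrib sum_subtractf power_one_right)
    qed
    then show ?thesis
      using rest by (subst landau_o.big.in_cong)
  qed

  have HJE: "(\<lambda>H. H * JE r \<kappa> H) \<in> ?O (Suc i)"
    if E: "\<And>r \<mu>. r \<in> R \<Longrightarrow> \<mu> < d \<Longrightarrow> E r \<mu> \<in> ?O i" and "\<kappa> < d" for r \<kappa> i
  proof -
    have "JE r \<kappa> \<in> ?O i"
      unfolding JE_def
      by (intro big_sum_in_bigo bigo_cmult bigo_mult_power[OF J0 E nhds]) (use that in auto)
    from bigo_mult_power[OF pow[OF order_refl, of 1] this nhds, of "Suc i"] show ?thesis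
      by simp
  qed

  \<comment> \<open>\<open>e2\<close> will be the full H^2 coefficient of the stage error, whereas
    \<open>g2\<close> and \<open>g3\<close> are only the direct defect contributions to H^3 and
    H^4.\<close>
  define e2 where "e2 r \<kappa> = (\<Sum>\<sigma>\<in>S. a \<sigma> \<kappa> 1 * D 1 \<sigma> r)" for r \<kappa>
  define g2 where "g2 r \<kappa> = (\<Sum>\<sigma>\<in>S. a \<sigma> \<kappa> 2 * D 2 \<sigma> r)" for r \<kappa>
  define g3 where "g3 r \<kappa> = (\<Sum>\<sigma>\<in>S. a \<sigma> \<kappa> 3 * D 3 \<sigma> r)" for r \<kappa>
  have main_split: "main r \<kappa> H = e2 r \<kappa> * H ^ 2 + g2 r \<kappa> * H ^ 3 + g3 r \<kappa> * H ^ 4" if "r \<in> R" for r \<kappa> H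
  proof -
    have "D 0 \<sigma> r = 0" if "\<sigma> \<in> S" for \<sigma>
      using rows[OF that \<open>r \<in> R\<close>] by (simp add: D_def)
    moreover have "(\<Sum>k<4. a \<sigma> \<kappa> k * D k \<sigma> r * H ^ Suc k) =
        a \<sigma> \<kappa> 0 * D 0 \<sigma> r * H + a \<sigma> \<kappa> 1 * D 1 \<sigma> r * H ^ 2 + a \<sigma> \<kappa> 2 * D 2 \<sigma> r * H ^ 3 + a \<sigma> \<kappa> 3 * D 3 \<sigma> r * H ^ 4" for \<sigma>
      by (simp add: numeral_eq_Suc)
    ultimately show ?thesis
      by (simp add: main_def e2_def g2_def g3_def sum.distrib sum_distrib_right)
  qed
  have main_2: "main r \<kappa> \<in> ?O 2" and main_3: "(\<lambda>H. main r \<kappa> H - e2 r \<kappa> * H ^ 2) \<in> ?O 3"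
    and main_4: "(\<lambda>H. main r \<kappa> H - e2 r \<kappa> * H ^ 2 - g2 r \<kappa> * H ^ 3) \<in> ?O 4" if "r \<in> R" for r \<kappa>
    unfolding main_split[OF that]
    by (auto intro!: sum_in_bigo bigo_cmult pow)

  have E0: "E r \<mu> \<in> ?O 0" if "r \<in> R" for r \<mu>
    using E_lim[OF that] by (intro bigoI_tendsto[where c = 0]) auto
  \<comment> \<open>Propagated errors carry an extra factor \<open>H\<close>, so a bound O(H^i)
    makes \<open>E\<close> agree with \<open>main\<close> up to O(H^(i+1)).\<close>
  have bootstrap: "(\<lambda>H. E r \<kappa> H - L H) \<in> ?O m"
    if E: "\<And>r \<mu>. r \<in> R \<Longrightarrow> \<mu> < d \<Longrightarrow> E r \<mu> \<in> ?O i" and "r \<in> R" "\<kappa> < d"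
      and L: "(\<lambda>H. main r \<kappa> H - L H) \<in> ?O m" and m: "m \<le> Suc i" "m \<le> 5" for r \<kappa> L i m
  proof -
    have "(\<lambda>H. E r \<kappa> H - main r \<kappa> H - H * JE r \<kappa> H) \<in> ?O m"
      by (rule master[OF E]) (use m \<open>r \<in> R\<close> \<open>\<kappa> < d\<close> in auto)
    moreover have "(\<lambda>H. H * JE r \<kappa> H) \<in> ?O m"
      by (rule bigo_mono[OF HJE[OF E]]) (use m \<open>\<kappa> < d\<close> in auto)
    ultimately have "(\<lambda>H. E r \<kappa> H - main r \<kappa> H - H * JE r \<kappa> H + H * JE r \<kappa> H + (main r \<kappa> H - L H)) \<in> ?O m"
      using L by (intro sum_in_bigo(1))
    then show ?thesis
      by simp
  qed
  have E1: "E r \<mu> \<in> ?O 1" if "r \<in> R" "\<mu> < d" for r \<mu>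
    using bootstrap[OF E0 that, of "\<lambda>_. 0" 1] bigo_mono[OF main_2, of r 1 \<mu>] that by simp
  have E2: "E r \<mu> \<in> ?O 2" if "r \<in> R" "\<mu> < d" for r \<mu>
    using bootstrap[OF E1 that, of "\<lambda>_. 0" 2] main_2[of r \<mu>] that by simp
  have E3: "(\<lambda>H. E r \<mu> H - e2 r \<mu> * H ^ 2) \<in> ?O 3" if "r \<in> R" "\<mu> < d" for r \<mu>
    using that by (intro bootstrap[OF E2] main_3) auto
  \<comment> \<open>The H^3 coefficient: the direct defect plus \<open>e2\<close> propagated once
    through the Jacobian at \<open>t0\<close>.\<close>
  define e3 where "e3 r \<kappa> = g2 r \<kappa> + (\<Sum>\<sigma>\<in>S. \<Sum>q\<in>R. A \<sigma> r q * (\<Sum>\<mu><d. j0 \<sigma> \<kappa> \<mu> * e2 q \<mu>))" for r \<kappa>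
  have JE_3: "(\<lambda>H. J \<sigma> \<kappa> \<mu> (c q * H) * E q \<mu> H - j0 \<sigma> \<kappa> \<mu> * e2 q \<mu> * H ^ 2) \<in> ?O 3"
    if "\<sigma> \<in> S" "q \<in> R" "\<kappa> < d" "\<mu> < d" for \<sigma> \<kappa> \<mu> q
  proof -
    have "(\<lambda>H. (J \<sigma> \<kappa> \<mu> (c q * H) - j0 \<sigma> \<kappa> \<mu>) * E q \<mu> H) \<in> ?O 3"
      by (rule bigo_mult_power[OF J1 E2 nhds]) (use that in auto)
    moreover have "(\<lambda>H. j0 \<sigma> \<kappa> \<mu> * (E q \<mu> H - e2 q \<mu> * H ^ 2)) \<in> ?O 3"
      using that by (intro bigo_cmult E3)
    ultimately have "(\<lambda>H. (J \<sigma> \<kappa> \<mu> (c q * H) - j0 \<sigma> \<kappa> \<mu>) * E q \<mu> H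
        + j0 \<sigma> \<kappa> \<mu> * (E q \<mu> H - e2 q \<mu> * H ^ 2)) \<in> ?O 3"
      by (rule sum_in_bigo(1))
    then show ?thesis
      by (simp add: algebra_simps)
  qed
  have E4: "(\<lambda>H. E r \<kappa> H - e2 r \<kappa> * H ^ 2 - e3 r \<kappa> * H ^ 3) \<in> ?O 4" if "r \<in> R" "\<kappa> < d" for r \<kappa>
  proof -
    have "(\<lambda>H. \<Sum>\<sigma>\<in>S. \<Sum>q\<in>R. A \<sigma> r q *
        (\<Sum>\<mu><d. J \<sigma> \<kappa> \<mu> (c q * H) * E q \<mu> H - j0 \<sigma> \<kappa> \<mu> * e2 q \<mu> * H ^ 2)) \<in> ?O 3"
      by (intro big_sum_in_bigo bigo_cmult JE_3) (use that in auto)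
    from bigo_mult_power[OF pow[OF order_refl, of 1] this nhds, of 4]
    have "(\<lambda>H. H * (\<Sum>\<sigma>\<in>S. \<Sum>q\<in>R. A \<sigma> r q *
        (\<Sum>\<mu><d. J \<sigma> \<kappa> \<mu> (c q * H) * E q \<mu> H - j0 \<sigma> \<kappa> \<mu> * e2 q \<mu> * H ^ 2))) \<in> ?O 4"
      by simp
    also have "(\<lambda>H. H * (\<Sum>\<sigma>\<in>S. \<Sum>q\<in>R. A \<sigma> r q *
        (\<Sum>\<mu><d. J \<sigma> \<kappa> \<mu> (c q * H) * E q \<mu> H - j0 \<sigma> \<kappa> \<mu> * e2 q \<mu> * H ^ 2))) =
        (\<lambda>H. H * JE r \<kappa> H - (e3 r \<kappa> - g2 r \<kappa>) * H ^ 3)"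
      by (simp add: JE_def e3_def sum_subtractf right_diff_distrib sum_distrib_left sum_distrib_right
          power2_eq_square power3_eq_cube mult_ac fun_eq_iff)
    finally have "(\<lambda>H. H * JE r \<kappa> H - (e3 r \<kappa> - g2 r \<kappa>) * H ^ 3) \<in> ?O 4" .
    moreover have "(\<lambda>H. E r \<kappa> H - main r \<kappa> H - H * JE r \<kappa> H) \<in> ?O 4"
      by (rule master[OF E2]) (use that in auto)
    ultimately have "(\<lambda>H. (E r \<kappa> H - main r \<kappa> H - H * JE r \<kappa> H) +
        (H * JE r \<kappa> H - (e3 r \<kappa> - g2 r \<kappa>) * H ^ 3) +
        (main r \<kappa> H - e2 r \<kappa> * H ^ 2 - g2 r \<kappa> * H ^ 3)) \<in> ?O 4"
      using main_4[OF \<open>r \<in> R\<close>] by (intro sum_in_bigo(1))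
    then show ?thesis
      by (simp add: algebra_simps)
  qed

  have main_l: "main l \<kappa> H = 0" for H
    using quad by (simp add: main_def D_def c_last)
  \<comment> \<open>The expansions of Jacobian and stage error are multiplied. Under the weights of
    the last stage, \<open>cond_1\<close> removes the H^2 term and \<open>cond_c1\<close> the term
    with \<open>j1\<close>; the two parts of \<open>e3\<close> fall to \<open>cond_2\<close> and
    \<open>cond_A1\<close>.\<close>
  have JE_4: "(\<lambda>H. J \<sigma> \<kappa> \<mu> (c q * H) * E q \<mu> H
      - (j0 \<sigma> \<kappa> \<mu> * e2 q \<mu> * H ^ 2 + (j0 \<sigma> \<kappa> \<mu> * e3 q \<mu> + j1 \<sigma> \<kappa> \<mu> * c q * e2 q \<mu>) * H ^ 3)) \<in> ?O 4"
    if "\<sigma> \<in> S" "q \<in> R" "\<mu> < d" for \<sigma> \<mu> q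
  proof -
    have "(\<lambda>H. (J \<sigma> \<kappa> \<mu> (c q * H) - j0 \<sigma> \<kappa> \<mu> - j1 \<sigma> \<kappa> \<mu> * (c q * H)) * E q \<mu> H) \<in> ?O 4"
      by (rule bigo_mult_power[OF J2 E2 nhds]) (use that \<open>\<kappa> < d\<close> in auto)
    moreover have "(\<lambda>H. j0 \<sigma> \<kappa> \<mu> * (E q \<mu> H - e2 q \<mu> * H ^ 2 - e3 q \<mu> * H ^ 3)) \<in> ?O 4"
      using that by (intro bigo_cmult E4)
    moreover have "(\<lambda>H. (j1 \<sigma> \<kappa> \<mu> * c q) * (H ^ 1 * (E q \<mu> H - e2 q \<mu> * H ^ 2))) \<in> ?O 4"
      by (intro bigo_cmult bigo_mult_power[OF pow[OF order_refl] E3 nhds]) (use that in auto)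
    ultimately have "(\<lambda>H. (J \<sigma> \<kappa> \<mu> (c q * H) - j0 \<sigma> \<kappa> \<mu> - j1 \<sigma> \<kappa> \<mu> * (c q * H)) * E q \<mu> H
        + j0 \<sigma> \<kappa> \<mu> * (E q \<mu> H - e2 q \<mu> * H ^ 2 - e3 q \<mu> * H ^ 3)
        + (j1 \<sigma> \<kappa> \<mu> * c q) * (H ^ 1 * (E q \<mu> H - e2 q \<mu> * H ^ 2))) \<in> ?O 4"
      by (intro sum_in_bigo(1))
    then show ?thesis
      by (simp add: algebra_simps power2_eq_square power3_eq_cube)
  qed
  have e2_0: "(\<Sum>q\<in>R. A \<sigma> l q * e2 q \<mu>) = 0" "(\<Sum>q\<in>R. A \<sigma> l q * (c q * e2 q \<mu>)) = 0"
    if "\<sigma> \<in> S" for \<sigma> \<mu>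
    using sum_weight_linear[where A = "A \<sigma> l" and w = "\<lambda>_. 1" and D = "D 1" and x = "\<lambda>\<nu>. a \<nu> \<mu> 1"]
      sum_weight_linear[where A = "A \<sigma> l" and w = c and D = "D 1" and x = "\<lambda>\<nu>. a \<nu> \<mu> 1"]
      cond_1[OF that] cond_c1[OF that] by (simp_all add: e2_def)
  have e3_0: "(\<Sum>q\<in>R. A \<sigma> l q * e3 q \<mu>) = 0" if "\<sigma> \<in> S" for \<sigma> \<mu>
  proof -
    have g2_0: "(\<Sum>q\<in>R. A \<sigma> l q * g2 q \<mu>) = 0"
      using sum_weight_linear[where A = "A \<sigma> l" and w = "\<lambda>_. 1" and D = "D 2" and x = "\<lambda>\<nu>. a \<nu> \<mu> 2"]
        cond_2[OF that] by (simp add: g2_def)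
    define G where "G \<nu> q \<mu>' = (\<Sum>p\<in>R. A \<nu> q p * e2 p \<mu>')" for \<nu> q \<mu>'
    have "G \<nu> q \<mu>' = (\<Sum>\<tau>\<in>S. a \<tau> \<mu>' 1 * (\<Sum>p\<in>R. A \<nu> q p * D 1 \<tau> p))" for \<nu> q \<mu>'
      unfolding G_def e2_def sum_distrib_left by (subst sum.swap) (simp add: mult_ac)
    then have G: "(\<Sum>q\<in>R. A \<sigma> l q * G \<nu> q \<mu>') = 0" if "\<nu> \<in> S" for \<nu> \<mu>'
      using sum_weight_linear[where A = "A \<sigma> l" and w = "\<lambda>_. 1" and D = "\<lambda>\<tau> q. \<Sum>p\<in>R. A \<nu> q p * D 1 \<tau> p"
          and x = "\<lambda>\<tau>. a \<tau> \<mu>' 1"] cond_A1[OF \<open>\<sigma> \<in> S\<close> that] by simp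
    have "(\<Sum>p\<in>R. A \<nu> q p * (\<Sum>\<mu>'<d. j0 \<nu> \<mu> \<mu>' * e2 p \<mu>')) = (\<Sum>\<mu>'<d. j0 \<nu> \<mu> \<mu>' * G \<nu> q \<mu>')" for \<nu> q
      unfolding G_def sum_distrib_left by (subst sum.swap) (simp add: mult_ac)
    then have "e3 q \<mu> = g2 q \<mu> + (\<Sum>\<nu>\<in>S. \<Sum>\<mu>'<d. j0 \<nu> \<mu> \<mu>' * G \<nu> q \<mu>')" for q
      by (simp add: e3_def)
    moreover have "(\<Sum>q\<in>R. A \<sigma> l q * (\<Sum>\<nu>\<in>S. \<Sum>\<mu>'<d. j0 \<nu> \<mu> \<mu>' * G \<nu> q \<mu>')) =
        (\<Sum>\<nu>\<in>S. \<Sum>\<mu>'<d. j0 \<nu> \<mu> \<mu>' * (\<Sum>q\<in>R. A \<sigma> l q * G \<nu> q \<mu>'))"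
      unfolding sum_distrib_left
      by (subst sum.swap, intro sum.cong refl, subst sum.swap) (simp add: mult_ac)
    ultimately show ?thesis
      using G by (simp add: distrib_left sum.distrib g2_0)
  qed
  have lead_0: "(\<Sum>q\<in>R. A \<sigma> l q * (\<Sum>\<mu><d. j0 \<sigma> \<kappa> \<mu> * e2 q \<mu> * H ^ 2
      + (j0 \<sigma> \<kappa> \<mu> * e3 q \<mu> + j1 \<sigma> \<kappa> \<mu> * c q * e2 q \<mu>) * H ^ 3)) = 0" if "\<sigma> \<in> S" for \<sigma> H
  proof -
    have "(\<Sum>q\<in>R. A \<sigma> l q * (\<Sum>\<mu><d. j0 \<sigma> \<kappa> \<mu> * e2 q \<mu> * H ^ 2
      + (j0 \<sigma> \<kappa> \<mu> * e3 q \<mu> + j1 \<sigma> \<kappa> \<mu> * c q * e2 q \<mu>) * H ^ 3)) =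
      (\<Sum>\<mu><d. j0 \<sigma> \<kappa> \<mu> * H ^ 2 * (\<Sum>q\<in>R. A \<sigma> l q * e2 q \<mu>)
        + j0 \<sigma> \<kappa> \<mu> * H ^ 3 * (\<Sum>q\<in>R. A \<sigma> l q * e3 q \<mu>)
        + j1 \<sigma> \<kappa> \<mu> * H ^ 3 * (\<Sum>q\<in>R. A \<sigma> l q * (c q * e2 q \<mu>)))"
      unfolding sum_distrib_left sum.distrib[symmetric]
      by (subst sum.swap) (simp add: algebra_simps)
    then show ?thesis
      by (simp only: e2_0[OF that] e3_0[OF that]) simp
  qed
  have "(\<lambda>H. \<Sum>\<sigma>\<in>S. \<Sum>q\<in>R. A \<sigma> l q * (\<Sum>\<mu><d. J \<sigma> \<kappa> \<mu> (c q * H) * E q \<mu> H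
      - (j0 \<sigma> \<kappa> \<mu> * e2 q \<mu> * H ^ 2 + (j0 \<sigma> \<kappa> \<mu> * e3 q \<mu> + j1 \<sigma> \<kappa> \<mu> * c q * e2 q \<mu>) * H ^ 3))) \<in> ?O 4"
    by (intro big_sum_in_bigo bigo_cmult JE_4) auto
  then have "JE l \<kappa> \<in> ?O 4"
    by (simp add: JE_def[abs_def] sum_subtractf right_diff_distrib lead_0)
  from bigo_mult_power[OF pow[OF order_refl, of 1] this nhds, of 5]
  have "(\<lambda>H. H * JE l \<kappa> H) \<in> ?O 5"
    by simp
  moreover have "(\<lambda>H. E l \<kappa> H - main l \<kappa> H - H * JE l \<kappa> H) \<in> ?O 5"
    by (rule master[OF E2]) (use \<open>l \<in> R\<close> \<open>\<kappa> < d\<close> in auto)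
  ultimately have "(\<lambda>H. E l \<kappa> H - main l \<kappa> H - H * JE l \<kappa> H + H * JE l \<kappa> H) \<in> ?O 5"
    by (intro sum_in_bigo(1))
  then have "E l \<kappa> \<in> ?O 5"
    by (simp add: main_l)
  from sum_in_bigo(2)[OF this yP[OF \<open>\<kappa> < d\<close>]] show ?thesis
    using \<open>\<kappa> < d\<close> by (simp add: E_def c_last)
qed


section \<open>Order conditions from accuracy\<close>

text \<open>For the triangular test system, these are the stage coefficient, the exponent of the
  step size and the coefficient of the exact solution. Indices are shifted by one: index 0 stands
  for the constant 1 that starts the chain, index \<open>Suc \<kappa>\<close> for the component
  \<open>\<kappa>\<close>.\<close>

primrec chain_weight ::
  "nat \<Rightarrow> (part \<Rightarrow> mtx) \<Rightarrow> (nat \<Rightarrow> real) \<Rightarrow> (nat \<Rightarrow> part) \<Rightarrow> (nat \<Rightarrow> nat) \<Rightarrow> nat \<Rightarrow> nat \<Rightarrow> real" where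
  "chain_weight s A c col e 0 = (\<lambda>i. 1)"
| "chain_weight s A c col e (Suc \<kappa>) =
    (\<lambda>i. \<Sum>j=1..s. A (col \<kappa>) i j * (c j ^ e \<kappa> * chain_weight s A c col e \<kappa> j))"

primrec chain_degree :: "(nat \<Rightarrow> nat) \<Rightarrow> nat \<Rightarrow> nat" where
  "chain_degree e 0 = 0"
| "chain_degree e (Suc \<kappa>) = Suc (chain_degree e \<kappa> + e \<kappa>)"

primrec chain_coeff :: "(nat \<Rightarrow> nat) \<Rightarrow> nat \<Rightarrow> real" where
  "chain_coeff e 0 = 1"
| "chain_coeff e (Suc \<kappa>) = chain_coeff e \<kappa> / real (chain_degree e (Suc \<kappa>))"

section \<open>Smoothness of monomial test problems and comparison of coefficients\<close>

lemma continuous_monomial_rhs: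
  "continuous_on UNIV (\<lambda>(t, x :: state). a * t ^ k * x \<mu> :: real)"
proof -
  have "continuous_on UNIV (\<lambda>p :: real \<times> state. snd p \<mu>)"
    by (rule continuous_on_product_then_coordinatewise) (intro continuous_intros)
  then show ?thesis
    unfolding case_prod_beta by (intro continuous_intros)
qed

lemma Ck_SucI:
  assumes "continuous_on UNIV (\<lambda>(t, x). g t x)"
    and "\<And>t x. ((\<lambda>s. g s x) has_real_derivative gt t x) (at t)" "Ck d m gt"
    and "\<And>\<kappa> t x. ((\<lambda>s. g t (x(\<kappa> := s))) has_real_derivative gx \<kappa> t x) (at (x \<kappa>))" "\<And>\<kappa>. Ck d m (gx \<kappa>)"
  shows "Ck d (Suc m) g"
  unfolding Ck.simps using assms by blast

lemma Ck_power: "Ck d m (\<lambda>t x. a * t ^ k)"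
proof (induction m arbitrary: a k)
  case 0
  then show ?case
    by (auto simp: case_prod_beta intro!: continuous_intros)
next
  case (Suc m)
  show ?case
  proof (rule Ck_SucI)
    \<comment> \<open>For \<open>k = 0\<close> the truncated exponent is harmless because the factor
      \<open>real k\<close> vanishes.\<close>
    show "((\<lambda>s. a * s ^ k) has_real_derivative (a * real k) * t ^ (k - 1)) (at t)" for t
      by (auto intro!: derivative_eq_intros)
    show "((\<lambda>s. a * t ^ k) has_real_derivative 0 * t ^ 0) (at (x \<kappa>))" for t \<kappa> and x :: state
      by simp
    show "Ck d m (\<lambda>t x. 0 * t ^ 0)"
      by (rule Suc)
  qed (use Suc in \<open>auto simp: case_prod_beta intro!: continuous_intros\<close>)
qed

lemma Ck_monomial: "Ck d m (\<lambda>t x. a * t ^ k * x \<mu>)"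
proof (induction m arbitrary: a k)
  case 0
  then show ?case
    using continuous_monomial_rhs by simp
next
  case (Suc m)
  show ?case
  proof (rule Ck_SucI)
    show "((\<lambda>s. a * s ^ k * x \<mu>) has_real_derivative (a * real k) * t ^ (k - 1) * x \<mu>) (at t)"
      for t and x :: state
      by (auto intro!: derivative_eq_intros)
    show "((\<lambda>s. a * t ^ k * (x(\<kappa> := s)) \<mu>) has_real_derivative (if \<kappa> = \<mu> then a else 0) * t ^ k) (at (x \<kappa>))"
      for \<kappa> t and x :: state
      by (auto intro!: derivative_eq_intros)
  qed (use Suc Ck_power continuous_monomial_rhs in auto)
qed

lemma bigo_monomial_zero:
  fixes a :: real
  assumes "(\<lambda>H. a * H ^ n) \<in> O[at_right 0](\<lambda>H. H ^ (p + 1))" "n \<le> p"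
  shows "a = 0"
proof -
  have "(\<lambda>H. a * H ^ n) \<in> O[at_right 0](\<lambda>H. H ^ Suc n)"
    using assms by (intro bigo_power_le[OF assms(1)]) (auto simp: at_within_def)
  then obtain C where "\<forall>\<^sub>F H in at_right 0. norm (a * H ^ n) \<le> C * norm (H ^ Suc n)"
    by (elim landau_o.bigE)
  then have "\<forall>\<^sub>F H in at_right 0. \<bar>a\<bar> \<le> C * H"
    using eventually_at_right_less[of "0 :: real"]
  proof eventually_elim
    case (elim H)
    then have "\<bar>a\<bar> * H ^ n \<le> (C * H) * H ^ n"
      by (simp add: abs_mult mult_ac)
    then show ?case
      using elim(2) by simp
  qed
  moreover have "((\<lambda>H. C * H) \<longlongrightarrow> 0) (at_right 0)"
    by (auto intro!: tendsto_eq_intros)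
  ultimately have "\<bar>a\<bar> \<le> 0"
    by (intro tendsto_lowerbound) auto
  then show ?thesis
    by simp
qed

text \<open>The smoothness that \<open>accurate\<close> demands is hidden behind an existential,
  hence a test problem has to be smooth of every degree.\<close>

lemma accurateD:
  assumes "accurate p P St step"
    and smooth: "\<And>m \<sigma>. \<sigma> \<in> P \<Longrightarrow> smooth_rhs d m (f \<sigma>)"
    and "T > 0" "exact_solution d P f t0 T y"
    and "\<forall>\<^sub>F H in at_right 0. step d f t0 (y t0) H (Y H) (z H)"
    and "\<And>r \<kappa>. r \<in> St \<Longrightarrow> \<kappa> < d \<Longrightarrow> ((\<lambda>H. Y H r \<kappa>) \<longlongrightarrow> y t0 \<kappa>) (at_right 0)"
    and "\<kappa> < d"
  shows "(\<lambda>H. z H \<kappa> - y (t0 + H) \<kappa>) \<in> O[at_right 0](\<lambda>H. H ^ (p + 1))"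
proof -
  from assms(1)[unfolded accurate_def] show ?thesis
  proof (elim exE)
    fix m
    assume m: "\<forall>d f t0 T y Y z.
        (\<forall>\<sigma>\<in>P. smooth_rhs d m (f \<sigma>)) \<longrightarrow> T > 0 \<longrightarrow> exact_solution d P f t0 T y \<longrightarrow>
        (\<forall>\<^sub>F H in at_right 0. step d f t0 (y t0) H (Y H) (z H)) \<longrightarrow>
        (\<forall>r\<in>St. \<forall>\<kappa><d. ((\<lambda>H. Y H r \<kappa>) \<longlongrightarrow> y t0 \<kappa>) (at_right 0)) \<longrightarrow>
        (\<forall>\<kappa><d. (\<lambda>H. z H \<kappa> - y (t0 + H) \<kappa>) \<in> O[at_right 0](\<lambda>H. H ^ (p + 1)))"
    show ?thesis
      by (rule m[THEN spec[of _ d], THEN spec[of _ f], THEN spec[of _ t0], THEN spec[of _ T], THEN spec[of _ y],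
            THEN spec[of _ Y], THEN spec[of _ z], rule_format])
         (use assms in auto)
  qed
qed

text \<open>The order condition of an unbranched tree is read off the triangular system
  \<open>x\<^sub>\<kappa>' = t ^ e \<kappa> * x\<^sub>\<kappa>\<^sub>-\<^sub>1\<close> with \<open>x\<^sub>-\<^sub>1 = 1\<close>, the \<open>\<kappa>\<close>-th equation being assigned to the
  part \<open>col \<kappa>\<close>: its stages and its exact solution are monomials in the step size.\<close>

lemma chain_condition:
  fixes A :: "part \<Rightarrow> mtx" and b :: "part \<Rightarrow> nat \<Rightarrow> real"
  assumes acc: "accurate p S {1..s} step"
    and step: "\<And>d f t0 y0 H Y z.
      (\<forall>i\<in>{1..s}. \<forall>\<kappa><d. Y i \<kappa> = y0 \<kappa> +
        H * (\<Sum>\<sigma>\<in>S. \<Sum>j=1..s. A \<sigma> i j * f \<sigma> (t0 + c j * H) (Y j) \<kappa>)) \<Longrightarrow>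
      (\<forall>\<kappa><d. z \<kappa> = y0 \<kappa> + H * (\<Sum>\<sigma>\<in>S. \<Sum>j=1..s. b \<sigma> j * f \<sigma> (t0 + c j * H) (Y j) \<kappa>)) \<Longrightarrow>
      step d f t0 y0 H Y z"
    and "finite S" and col: "\<And>\<mu>. col \<mu> \<in> S"
    and deg: "chain_degree e (Suc \<kappa>) \<le> p"
  shows "(\<Sum>j=1..s. b (col \<kappa>) j * (c j ^ e \<kappa> * chain_weight s A c col e \<kappa> j)) = chain_coeff e (Suc \<kappa>)"
proof -
  let ?W = "chain_weight s A c col e" and ?N = "chain_degree e" and ?g = "chain_coeff e"
  define pred where "pred x \<mu> = (case \<mu> of 0 \<Rightarrow> 1 | Suc \<nu> \<Rightarrow> x \<nu>)" for x :: state and \<mu>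
  define f where "f \<sigma> t x \<mu> = (if \<sigma> = col \<mu> then t ^ e \<mu> * pred x \<mu> else 0)" for \<sigma> t x \<mu>
  define y :: "real \<Rightarrow> state" where "y t \<mu> = ?g (Suc \<mu>) * t ^ ?N (Suc \<mu>)" for t \<mu>
  \<comment> \<open>Stages are written down in closed form, so even for an implicit tableau no
    equation has to be solved.\<close>
  define Y :: "real \<Rightarrow> nat \<Rightarrow> state" where "Y H i \<mu> = ?W (Suc \<mu>) i * H ^ ?N (Suc \<mu>)" for H i \<mu>
  define w where "w \<mu> = (\<Sum>j=1..s. b (col \<mu>) j * (c j ^ e \<mu> * ?W \<mu> j))" for \<mu>
  define z :: "real \<Rightarrow> state" where "z H \<mu> = w \<mu> * H ^ ?N (Suc \<mu>)" for H \<mu>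
  have f_sum: "(\<Sum>\<sigma>\<in>S. f \<sigma> t x \<mu>) = t ^ e \<mu> * pred x \<mu>" for t x \<mu>
    using \<open>finite S\<close> col by (simp add: f_def sum.delta')
  have pred_y: "pred (y t) \<mu> = ?g \<mu> * t ^ ?N \<mu>" and pred_Y: "pred (Y H j) \<mu> = ?W \<mu> j * H ^ ?N \<mu>" for t H j \<mu>
    by (auto simp: pred_def y_def Y_def split: nat.split)
  have y_0: "y 0 \<mu> = 0" for \<mu>
    by (simp add: y_def)
  have weights: "H * (\<Sum>\<sigma>\<in>S. \<Sum>j=1..s. B \<sigma> j * f \<sigma> (c j * H) (Y H j) \<mu>) =
      (\<Sum>j=1..s. B (col \<mu>) j * (c j ^ e \<mu> * ?W \<mu> j)) * H ^ ?N (Suc \<mu>)" for B :: "part \<Rightarrow> nat \<Rightarrow> real" and H \<mu>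
  proof -
    have "(\<Sum>\<sigma>\<in>S. \<Sum>j=1..s. B \<sigma> j * f \<sigma> (c j * H) (Y H j) \<mu>) =
        (\<Sum>\<sigma>\<in>S. if \<sigma> = col \<mu> then \<Sum>j=1..s. B \<sigma> j * ((c j * H) ^ e \<mu> * (?W \<mu> j * H ^ ?N \<mu>)) else 0)"
      by (intro sum.cong refl) (simp add: f_def pred_Y)
    also have "\<dots> = (\<Sum>j=1..s. B (col \<mu>) j * ((c j * H) ^ e \<mu> * (?W \<mu> j * H ^ ?N \<mu>)))"
      using \<open>finite S\<close> col by (simp add: sum.delta')
    finally show ?thesis
      by (simp add: sum_distrib_left sum_distrib_right power_mult_distrib power_add mult_ac)
  qed
  have smooth: "smooth_rhs d m (f \<sigma>)" for \<sigma> d m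
    unfolding smooth_rhs_def
  proof (intro allI impI conjI)
    fix \<mu> assume "\<mu> < d"
    then show "depends_only d (\<lambda>t x. f \<sigma> t x \<mu>)"
      by (auto simp: depends_only_def f_def pred_def split: nat.split)
    show "Ck d m (\<lambda>t x. f \<sigma> t x \<mu>)"
      using Ck_power[of d m 0 0] Ck_power[of d m 1 "e \<mu>"] Ck_monomial[of d m 1 "e \<mu>"]
      by (cases "\<sigma> = col \<mu>"; cases \<mu>) (simp_all add: f_def pred_def)
  qed
  have exact: "exact_solution d S f 0 1 y" for d
    unfolding exact_solution_def f_sum pred_y
  proof (intro ballI allI impI)
    fix t :: real and \<mu>
    have der: "((\<lambda>t. y t \<mu>) has_real_derivative ?g (Suc \<mu>) * (real (?N (Suc \<mu>)) * t ^ (?N \<mu> + e \<mu>))) (at t)"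
      unfolding y_def
      using DERIV_cmult[OF DERIV_pow[of "?N (Suc \<mu>)" t], of "?g (Suc \<mu>)"]
      by (simp del: of_nat_Suc chain_coeff.simps)
    have eq: "?g (Suc \<mu>) * (real (?N (Suc \<mu>)) * t ^ (?N \<mu> + e \<mu>)) = t ^ e \<mu> * (?g \<mu> * t ^ ?N \<mu>)"
      by (simp add: power_add del: of_nat_Suc)
    show "((\<lambda>t. y t \<mu>) has_real_derivative t ^ e \<mu> * (?g \<mu> * t ^ ?N \<mu>)) (at t within {0..0 + 1})"
      using has_field_derivative_at_within[OF der] by (simp only: eq)
  qed
  have steps: "step d f 0 (y 0) H (Y H) (z H)" for d H
    by (rule step) (simp_all only: weights y_0 Y_def[of H] z_def w_def chain_weight.simps add_0 ball_triv simp_thms)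
  have lim: "((\<lambda>H. Y H r \<mu>) \<longlongrightarrow> y 0 \<mu>) (at_right 0)" for r \<mu>
    unfolding Y_def y_0 by (auto intro!: tendsto_eq_intros)
  have "(\<lambda>H. z H \<kappa> - y (0 + H) \<kappa>) \<in> O[at_right 0](\<lambda>H. H ^ (p + 1))"
    by (rule accurateD[OF acc, where d = "Suc \<kappa>" and f = f and T = 1 and Y = Y])
       (simp_all add: smooth exact[unfolded add_0] steps lim)
  then have "(\<lambda>H. (w \<kappa> - ?g (Suc \<kappa>)) * H ^ ?N (Suc \<kappa>)) \<in> O[at_right 0](\<lambda>H. H ^ (p + 1))"
    by (simp add: z_def y_def left_diff_distrib)
  from bigo_monomial_zero[OF this deg] show ?thesis
    by (simp add: w_def)
qed

text \<open>Chains of length one, two and three. With \<open>c\<close> equal to the row sums these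
  cover all rooted trees of order at most four: leaves become powers of \<open>c\<close>, and a
  vertex with two non-leaf children first occurs in order five.\<close>

lemma chain_conditions_3:
  fixes A :: "part \<Rightarrow> mtx" and b :: "part \<Rightarrow> nat \<Rightarrow> real"
  assumes acc: "accurate p S {1..s} step"
    and step: "\<And>d f t0 y0 H Y z.
      (\<forall>i\<in>{1..s}. \<forall>\<kappa><d. Y i \<kappa> = y0 \<kappa> +
        H * (\<Sum>\<sigma>\<in>S. \<Sum>j=1..s. A \<sigma> i j * f \<sigma> (t0 + c j * H) (Y j) \<kappa>)) \<Longrightarrow>
      (\<forall>\<kappa><d. z \<kappa> = y0 \<kappa> + H * (\<Sum>\<sigma>\<in>S. \<Sum>j=1..s. b \<sigma> j * f \<sigma> (t0 + c j * H) (Y j) \<kappa>)) \<Longrightarrow>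
      step d f t0 y0 H Y z"
    and "finite S" and col: "\<sigma> \<in> S" "\<nu> \<in> S" "\<mu> \<in> S"
  shows "k + 1 \<le> p \<Longrightarrow> (\<Sum>j=1..s. b \<sigma> j * c j ^ k) = 1 / (real k + 1)"
    and "k + l + 2 \<le> p \<Longrightarrow> (\<Sum>j=1..s. b \<sigma> j * (c j ^ l * (\<Sum>q=1..s. A \<nu> j q * c q ^ k))) =
      1 / ((real k + 1) * (real k + real l + 2))"
    and "k + 3 \<le> p \<Longrightarrow> (\<Sum>j=1..s. b \<sigma> j * (\<Sum>q=1..s. A \<nu> j q * (\<Sum>r=1..s. A \<mu> q r * c r ^ k))) =
      1 / ((real k + 1) * (real k + 2) * (real k + 3))"
proof -
  have chain: "(\<Sum>j=1..s. b (col \<kappa>) j * (c j ^ e \<kappa> * chain_weight s A c col e \<kappa> j)) = chain_coeff e (Suc \<kappa>)"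
    if "\<And>\<mu>. col \<mu> \<in> S" "chain_degree e (Suc \<kappa>) \<le> p" for col e \<kappa>
    by (rule chain_condition[OF acc _ \<open>finite S\<close> that]) (rule step; assumption)
  show "(\<Sum>j=1..s. b \<sigma> j * c j ^ k) = 1 / (real k + 1)" if "k + 1 \<le> p"
    using chain[where col = "\<lambda>_. \<sigma>" and e = "\<lambda>_. k" and \<kappa> = 0] that col by (simp add: add.commute)
  \<comment> \<open>Index 0 of \<open>col\<close> and \<open>e\<close> is the innermost sum, the
    highest index the one weighted by \<open>b\<close>.\<close>
  show "(\<Sum>j=1..s. b \<sigma> j * (c j ^ l * (\<Sum>q=1..s. A \<nu> j q * c q ^ k))) =
      1 / ((real k + 1) * (real k + real l + 2))" if "k + l + 2 \<le> p"
    using chain[where col = "(\<lambda>_. \<sigma>)(0 := \<nu>)" and e = "(\<lambda>_. l)(0 := k)" and \<kappa> = 1] that col by (simp add: add_ac)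
  show "(\<Sum>j=1..s. b \<sigma> j * (\<Sum>q=1..s. A \<nu> j q * (\<Sum>r=1..s. A \<mu> q r * c r ^ k))) =
      1 / ((real k + 1) * (real k + 2) * (real k + 3))" if "k + 3 \<le> p"
    using chain[where col = "(\<lambda>_. \<sigma>)(0 := \<mu>, 1 := \<nu>)" and e = "(\<lambda>_. 0)(0 := k)" and \<kappa> = 2] that col
    by (simp add: add_ac numeral_2_eq_2)
qed


section \<open>Multirate methods as additive methods\<close>

lemma rk_order_conditions:
  assumes "rk_accurate p s A b c"
  shows "k + 1 \<le> p \<Longrightarrow> (\<Sum>j=1..s. b j * c j ^ k) = 1 / (real k + 1)"
    and "k + l + 2 \<le> p \<Longrightarrow> (\<Sum>j=1..s. b j * (c j ^ l * (\<Sum>q=1..s. A j q * c q ^ k))) =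
      1 / ((real k + 1) * (real k + real l + 2))"
    and "k + 3 \<le> p \<Longrightarrow> (\<Sum>j=1..s. b j * (\<Sum>q=1..s. A j q * (\<Sum>r=1..s. A q r * c r ^ k))) =
      1 / ((real k + 1) * (real k + 2) * (real k + 3))"
  using chain_conditions_3[where S = "{Fast}" and A = "\<lambda>_. A" and b = "\<lambda>_. b" and c = c and s = s
      and step = "rk_step s A b c" and \<sigma> = Fast and \<nu> = Fast and \<mu> = Fast]
    assms by (simp_all add: rk_accurate_def rk_step_def)

text \<open>The value at \<open>Fast\<close> is a default: the coefficients of the multirate method
  consult the tableau only for the slow parts.\<close>

definition slow_tableau :: "nat \<Rightarrow> (nat \<Rightarrow> mtx) \<Rightarrow> mtx \<Rightarrow> part \<Rightarrow> mtx" where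
  "slow_tableau n \<Omega> \<Gamma> \<sigma> = (if \<sigma> = Impl then madd (Omega_bar n \<Omega>) \<Gamma> else Omega_bar n \<Omega>)"

text \<open>The explicit and implicit tableaux come with their own abscissae, which the row sum
  hypotheses merge into \<open>c\<close>. As \<open>\<sigma>\<close>, \<open>\<nu>\<close> and
  \<open>\<mu>\<close> vary independently, the coupling conditions between the two tableaux are
  included.\<close>

lemma slow_order_conditions:
  assumes acc: "slow_base_accurate p s n \<Omega> \<Gamma>"
    and c: "\<And>i. i \<in> {1..s} \<Longrightarrow> rowsum s (Omega_bar n \<Omega>) i = c i"
      "\<And>i. i \<in> {1..s} \<Longrightarrow> rowsum s (madd (Omega_bar n \<Omega>) \<Gamma>) i = c i"
    and "\<sigma> \<noteq> Fast" "\<nu> \<noteq> Fast" "\<mu> \<noteq> Fast"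
  shows "k + 1 \<le> p \<Longrightarrow> (\<Sum>j=1..s. slow_tableau n \<Omega> \<Gamma> \<sigma> s j * c j ^ k) = 1 / (real k + 1)"
    and "k + l + 2 \<le> p \<Longrightarrow>
      (\<Sum>j=1..s. slow_tableau n \<Omega> \<Gamma> \<sigma> s j * (c j ^ l * (\<Sum>q=1..s. slow_tableau n \<Omega> \<Gamma> \<nu> j q * c q ^ k))) =
      1 / ((real k + 1) * (real k + real l + 2))"
    and "k + 3 \<le> p \<Longrightarrow>
      (\<Sum>j=1..s. slow_tableau n \<Omega> \<Gamma> \<sigma> s j * (\<Sum>q=1..s. slow_tableau n \<Omega> \<Gamma> \<nu> j q *
        (\<Sum>r=1..s. slow_tableau n \<Omega> \<Gamma> \<mu> q r * c r ^ k))) =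
      1 / ((real k + 1) * (real k + 2) * (real k + 3))"
proof -
  let ?A = "slow_tableau n \<Omega> \<Gamma>"
  let ?step = "ark_step s (?A Expl) (?A Expl s) (rowsum s (?A Expl)) (?A Impl) (?A Impl s) (rowsum s (?A Impl))"
  have acc': "accurate p {Expl, Impl} {1..s} ?step"
    using acc by (simp add: slow_base_accurate_def slow_tableau_def Let_def)
  have step: "?step d f t0 y0 H Y z"
    if "\<forall>i\<in>{1..s}. \<forall>\<kappa><d. Y i \<kappa> = y0 \<kappa> +
        H * (\<Sum>\<sigma>\<in>{Expl, Impl}. \<Sum>j=1..s. ?A \<sigma> i j * f \<sigma> (t0 + c j * H) (Y j) \<kappa>)"
      "\<forall>\<kappa><d. z \<kappa> = y0 \<kappa> + H * (\<Sum>\<sigma>\<in>{Expl, Impl}. \<Sum>j=1..s. ?A \<sigma> s j * f \<sigma> (t0 + c j * H) (Y j) \<kappa>)"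
    for d f t0 y0 H Y z
  proof -
    have "(\<Sum>j=1..s. B j * f \<sigma> (t0 + rowsum s (?A \<sigma>) j * H) (Y j) \<kappa>) =
        (\<Sum>j=1..s. B j * f \<sigma> (t0 + c j * H) (Y j) \<kappa>)" for B \<sigma> \<kappa>
      by (intro sum.cong refl) (simp add: slow_tableau_def c)
    then show ?thesis
      using that by (simp add: ark_step_def distrib_left)
  qed
  have "\<sigma> \<in> {Expl, Impl}" "\<nu> \<in> {Expl, Impl}" "\<mu> \<in> {Expl, Impl}"
    using assms(4-6) by (auto intro: part.exhaust)
  from chain_conditions_3[where b = "\<lambda>\<sigma>. ?A \<sigma> s", OF acc' step _ this]
  show "k + 1 \<le> p \<Longrightarrow> (\<Sum>j=1..s. ?A \<sigma> s j * c j ^ k) = 1 / (real k + 1)"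
    and "k + l + 2 \<le> p \<Longrightarrow> (\<Sum>j=1..s. ?A \<sigma> s j * (c j ^ l * (\<Sum>q=1..s. ?A \<nu> j q * c q ^ k))) =
      1 / ((real k + 1) * (real k + real l + 2))"
    and "k + 3 \<le> p \<Longrightarrow>
      (\<Sum>j=1..s. ?A \<sigma> s j * (\<Sum>q=1..s. ?A \<nu> j q * (\<Sum>r=1..s. ?A \<mu> q r * c r ^ k))) =
      1 / ((real k + 1) * (real k + 2) * (real k + 3))"
    by blast+
qed

section \<open>Fast and slow stages over one index set\<close>

fun mri_abscissa :: "(nat \<Rightarrow> real) \<Rightarrow> (nat \<Rightarrow> real) \<Rightarrow> mri_stage \<Rightarrow> real" where
  "mri_abscissa c cF (Slow i) = c i"
| "mri_abscissa c cF (FastSt i j) = c i * cF j"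

text \<open>The rectangular GARK blocks are padded with zeros to square matrices over all stages:
  the fast part is evaluated only at fast stages, the slow parts only at slow ones.\<close>

fun mri_coeff ::
  "nat \<Rightarrow> (nat \<Rightarrow> mtx) \<Rightarrow> mtx \<Rightarrow> (nat \<Rightarrow> real) \<Rightarrow> nat \<Rightarrow> mtx \<Rightarrow> (nat \<Rightarrow> real) \<Rightarrow> (nat \<Rightarrow> real) \<Rightarrow>
   part \<Rightarrow> mri_stage \<Rightarrow> mri_stage \<Rightarrow> real" where
  "mri_coeff n \<Omega> \<Gamma> c sF AF bF cF \<sigma> (Slow i) (Slow l) = (if \<sigma> = Fast then 0 else slow_tableau n \<Omega> \<Gamma> \<sigma> i l)"
| "mri_coeff n \<Omega> \<Gamma> c sF AF bF cF \<sigma> (FastSt i j) (Slow l) = (if \<sigma> = Fast then 0 else A_FE n \<Omega> sF AF cF (i, j) l)"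
| "mri_coeff n \<Omega> \<Gamma> c sF AF bF cF \<sigma> (Slow i) (FastSt l m) = (if \<sigma> = Fast then A_SF c bF i (l, m) else 0)"
| "mri_coeff n \<Omega> \<Gamma> c sF AF bF cF \<sigma> (FastSt i j) (FastSt l m) = (if \<sigma> = Fast then A_FF c AF (i, j) (l, m) else 0)"

lemma sum_mri_stages:
  "(\<Sum>q\<in>mri_stages s sF. g q) = (\<Sum>i=1..s. g (Slow i)) + (\<Sum>i=2..s. \<Sum>j=1..sF. g (FastSt i j))"
proof -
  have "(\<Sum>q\<in>mri_stages s sF. g q) =
      (\<Sum>q\<in>Slow ` {1..s}. g q) + (\<Sum>q\<in>(\<lambda>(i, j). FastSt i j) ` ({2..s} \<times> {1..sF}). g q)"
    unfolding mri_stages_def by (intro sum.union_disjoint) auto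
  also have "\<dots> = (\<Sum>i=1..s. g (Slow i)) + (\<Sum>(i, j)\<in>{2..s} \<times> {1..sF}. g (FastSt i j))"
    by (subst (1 2) sum.reindex) (auto simp: inj_on_def case_prod_beta intro!: sum.cong)
  finally show ?thesis
    by (simp add: sum.cartesian_product)
qed

text \<open>The first slow stage has no fast subproblem, so the sum starts at 2; the row
  \<open>i = 1\<close> still fits since \<open>c 1 = 0\<close>.\<close>

lemma sum_diag_row:
  assumes "i \<in> {1..s}" "c 1 = 0"
  shows "(\<Sum>l=2..s. \<Sum>m=1..sF. diag c i l * w m * x l m) = c i * (\<Sum>m=1..sF. w m * x i m)"
proof (cases "i = 1")
  case True
  then show ?thesis
    using assms(2) by (auto simp: diag_def intro!: sum.neutral)
next
  case False
  have "(\<Sum>l=2..s. \<Sum>m=1..sF. diag c i l * w m * x l m) =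
      (\<Sum>l=2..s. if l = i then c i * (\<Sum>m=1..sF. w m * x i m) else 0)"
    by (intro sum.cong refl) (auto simp: diag_def sum_distrib_left mult_ac)
  then show ?thesis
    using False assms(1) by (simp add: sum.delta)
qed

lemma mri_coeff_sum:
  fixes w :: "mri_stage \<Rightarrow> real"
  assumes "i \<in> {1..s}" "c 1 = 0"
  shows "(\<Sum>q\<in>mri_stages s sF. mri_coeff n \<Omega> \<Gamma> c sF AF bF cF \<sigma> (Slow i) q * w q) =
      (if \<sigma> = Fast then c i * (\<Sum>m=1..sF. bF m * w (FastSt i m))
       else \<Sum>l=1..s. slow_tableau n \<Omega> \<Gamma> \<sigma> i l * w (Slow l))"
    and "(\<Sum>q\<in>mri_stages s sF. mri_coeff n \<Omega> \<Gamma> c sF AF bF cF \<sigma> (FastSt i j) q * w q) =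
      (if \<sigma> = Fast then c i * (\<Sum>m=1..sF. AF j m * w (FastSt i m))
       else \<Sum>l=1..s. A_FE n \<Omega> sF AF cF (i, j) l * w (Slow l))"
  by (simp_all add: sum_mri_stages A_SF_def A_FF_def sum_diag_row[where c = c, OF assms] del: One_nat_def)

text \<open>Weights \<open>u\<close> on the fast stages of one subproblem collapse their block to a
  combination of the matrices \<open>\<Omega> k\<close> with coefficients u^T AF cF^k. The choices
  bF, bF times cF elementwise, and bF^T AF produce the three matrices of the coupling
  conditions.\<close>

lemma sum_A_FE:
  assumes "\<And>k. k < n \<Longrightarrow> (\<Sum>m=1..sF. u m * (\<Sum>q=1..sF. AF m q * cF q ^ k)) = \<gamma> k"
  shows "(\<Sum>m=1..sF. u m * (\<Sum>l=1..s. A_FE n \<Omega> sF AF cF (i, m) l * w l)) = mv s (lincomb n \<gamma> \<Omega>) w i"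
proof -
  have "(\<Sum>m=1..sF. u m * A_FE n \<Omega> sF AF cF (i, m) l) =
      (\<Sum>k<n. \<Omega> k i l * (\<Sum>m=1..sF. u m * mv sF AF (\<lambda>m. cF m ^ k) m))" for l
    unfolding A_FE_def case_prod_conv sum_distrib_left by (subst sum.swap) (simp add: mult_ac)
  also have "\<dots>l = lincomb n \<gamma> \<Omega> i l" for l
    using assms by (simp add: lincomb_def mv_def mult.commute)
  finally have "(\<Sum>l=1..s. (\<Sum>m=1..sF. u m * A_FE n \<Omega> sF AF cF (i, m) l) * w l) = mv s (lincomb n \<gamma> \<Omega>) w i"
    by (simp add: mv_def)
  moreover have "(\<Sum>m=1..sF. u m * (\<Sum>l=1..s. A_FE n \<Omega> sF AF cF (i, m) l * w l)) =
      (\<Sum>l=1..s. (\<Sum>m=1..sF. u m * A_FE n \<Omega> sF AF cF (i, m) l) * w l)"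
    unfolding sum_distrib_left sum_distrib_right by (subst sum.swap) (simp add: mult_ac)
  ultimately show ?thesis
    by simp
qed

lemma omega_quadrature:
  "(\<Sum>j=1..sF. w j * omega n \<Omega> i l (cF j)) = (\<Sum>k<n. \<Omega> k i l * (\<Sum>j=1..sF. w j * cF j ^ k))"
  unfolding omega_def sum_distrib_left by (subst sum.swap) (simp add: mult_ac)

text \<open>At the end of a fast subproblem the powers of the forcing are averaged by
  \<open>bF\<close>. Exact quadrature for \<open>k < n\<close> turns these averages into 1/(k + 1),
  so that the slow rows carry \<open>Omega_bar\<close>.\<close>

lemma mri_step_stages:
  assumes mri: "imex_mri_sr s n \<Omega> \<Gamma> c"
    and bF: "\<And>k. k < n \<Longrightarrow> (\<Sum>j=1..sF. bF j * cF j ^ k) = 1 / (real k + 1)"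
    and step: "mri_step s n \<Omega> \<Gamma> c sF AF bF cF d f t0 y0 H Y z"
    and "r \<in> mri_stages s sF" "\<kappa> < d"
  shows "Y r \<kappa> = y0 \<kappa> + H * (\<Sum>\<sigma>\<in>UNIV. \<Sum>q\<in>mri_stages s sF. mri_coeff n \<Omega> \<Gamma> c sF AF bF cF \<sigma> r q *
      f \<sigma> (t0 + mri_abscissa c cF q * H) (Y q) \<kappa>)"
proof -
  have c_1: "c 1 = 0" and \<Gamma>_1: "\<And>l. l \<in> {1..s} \<Longrightarrow> \<Gamma> 1 l = 0"
    and \<Omega>_upper: "\<And>k i l. k < n \<Longrightarrow> i \<in> {1..s} \<Longrightarrow> l \<in> {1..s} \<Longrightarrow> i \<le> l \<Longrightarrow> \<Omega> k i l = 0"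
    and \<Gamma>_upper: "\<And>i l. i \<in> {1..s} \<Longrightarrow> l \<in> {1..s} \<Longrightarrow> i < l \<Longrightarrow> \<Gamma> i l = 0"
    using mri by (auto simp: imex_mri_sr_def)
  define fE where "fE l = f Expl (t0 + c l * H) (Y (Slow l)) \<kappa>" for l
  define fI where "fI l = f Impl (t0 + c l * H) (Y (Slow l)) \<kappa>" for l
  define fF where "fF i k = f Fast (t0 + c i * cF k * H) (Y (FastSt i k)) \<kappa>" for i k
  have parts: "(UNIV :: part set) = {Fast, Expl, Impl}"
    using part.exhaust by blast
  \<comment> \<open>Strict lower triangularity extends the inner sum from \<open>i - 1\<close> to
    all slow stages.\<close>
  have omega_sum: "(\<Sum>j=1..sF. w j * (\<Sum>l=1..i - 1. omega n \<Omega> i l (cF j) * g l)) =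
      (\<Sum>l=1..s. (\<Sum>k<n. \<Omega> k i l * (\<Sum>j=1..sF. w j * cF j ^ k)) * g l)" if i: "i \<in> {1..s}" for w g i
  proof -
    have "(\<Sum>l=1..i - 1. omega n \<Omega> i l (cF j) * g l) = (\<Sum>l=1..s. omega n \<Omega> i l (cF j) * g l)" for j
      using i by (intro sum.mono_neutral_left) (auto simp: omega_def \<Omega>_upper)
    then have "(\<Sum>j=1..sF. w j * (\<Sum>l=1..i - 1. omega n \<Omega> i l (cF j) * g l)) =
        (\<Sum>j=1..sF. w j * (\<Sum>l=1..s. omega n \<Omega> i l (cF j) * g l))"
      by (simp only:)
    also have "\<dots> = (\<Sum>l=1..s. (\<Sum>j=1..sF. w j * omega n \<Omega> i l (cF j)) * g l)"
      unfolding sum_distrib_left sum_distrib_right by (subst sum.swap) (simp add: mult_ac)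
    finally show ?thesis
      by (simp only: omega_quadrature)
  qed
  have bar: "(\<Sum>k<n. \<Omega> k i l * (\<Sum>j=1..sF. bF j * cF j ^ k)) = Omega_bar n \<Omega> i l" for i l
    by (simp add: bF Omega_bar_def lincomb_def del: One_nat_def)
  have A_FE: "(\<Sum>k<n. \<Omega> k i l * (\<Sum>m=1..sF. AF j m * cF m ^ k)) = A_FE n \<Omega> sF AF cF (i, j) l" for i j l
    by (simp add: A_FE_def mv_def)
  note coeff_sum = mri_coeff_sum[where c = c and s = s, OF _ c_1]
  from \<open>r \<in> mri_stages s sF\<close> consider (first) "r = Slow 1" "1 \<in> {1..s}"
    | (slow) i where "r = Slow i" "i \<in> {2..s}" "i \<in> {1..s}"
    | (fast) i j where "r = FastSt i j" "i \<in> {2..s}" "i \<in> {1..s}" "j \<in> {1..sF}"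
    unfolding mri_stages_def by fastforce
  then show ?thesis
  proof cases
    case first
    have "slow_tableau n \<Omega> \<Gamma> \<sigma> 1 l = 0" if "l \<in> {1..s}" for \<sigma> l
      using that \<Gamma>_1 \<Omega>_upper[OF _ first(2) that]
      by (auto simp: slow_tableau_def madd_def Omega_bar_def lincomb_def)
    moreover have "Y (Slow 1) \<kappa> = y0 \<kappa>"
      using step \<open>\<kappa> < d\<close> by (simp add: mri_step_def Let_def)
    ultimately show ?thesis
      unfolding first(1) parts using coeff_sum(1)[OF first(2)] c_1 by simp
  next
    case slow
    have "Y (Slow i) \<kappa> = y0 \<kappa> + c i * H * (\<Sum>j=1..sF. bF j * fF i j)
        + H * (\<Sum>j=1..sF. bF j * (\<Sum>l=1..i - 1. omega n \<Omega> i l (cF j) * (fE l + fI l)))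
        + H * (\<Sum>j=1..i. \<Gamma> i j * fI j)"
      using step slow(2) \<open>\<kappa> < d\<close> by (simp add: mri_step_def Let_def fE_def fI_def fF_def)
    moreover have "(\<Sum>j=1..i. \<Gamma> i j * fI j) = (\<Sum>j=1..s. \<Gamma> i j * fI j)"
      using slow(3) by (intro sum.mono_neutral_left) (auto simp: \<Gamma>_upper)
    ultimately show ?thesis
      unfolding slow(1) parts omega_sum[OF slow(3)] bar
      by (simp add: coeff_sum(1)[OF slow(3)])
        (simp add: fE_def fI_def fF_def slow_tableau_def madd_def
          distrib_left distrib_right sum.distrib mult_ac)
  next
    case fast
    have "Y (FastSt i j) \<kappa> = y0 \<kappa> + c i * H * (\<Sum>k=1..sF. AF j k * fF i k)
        + H * (\<Sum>k=1..sF. AF j k * (\<Sum>l=1..i - 1. omega n \<Omega> i l (cF k) * (fE l + fI l)))"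
      using step fast(2,4) \<open>\<kappa> < d\<close> by (simp add: mri_step_def Let_def fE_def fI_def fF_def)
    then show ?thesis
      unfolding fast(1) parts omega_sum[OF fast(3)] A_FE
      by (simp add: coeff_sum(2)[OF fast(3)])
        (simp add: fE_def fI_def fF_def
          distrib_left distrib_right sum.distrib mult_ac)
  qed
qed

lemma dot_unitvec: "1 \<le> s \<Longrightarrow> dot s (unitvec s) x = x s"
  by (simp add: dot_def unitvec_def if_distrib[of "\<lambda>u. u * _"] sum.delta' cong: if_cong)

lemma internally_consistent_rows:
  assumes "internally_consistent s n \<Omega> \<Gamma> c sF AF bF cF"
    and cF: "\<forall>j\<in>{1..sF}. cF j = rowsum sF AF j"
    and "i \<in> {1..s}"
  shows "rowsum s (Omega_bar n \<Omega>) i = c i"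
    and "rowsum s (madd (Omega_bar n \<Omega>) \<Gamma>) i = c i"
    and "j \<in> {1..sF} \<Longrightarrow> (\<Sum>l=1..s. A_FE n \<Omega> sF AF cF (i, j) l) = c i * cF j"
proof -
  show "rowsum s (Omega_bar n \<Omega>) i = c i" "rowsum s (madd (Omega_bar n \<Omega>) \<Gamma>) i = c i"
    using assms(1,3) by (auto simp: internally_consistent_def Let_def rowsum_def A_SE_def A_SI_def)
  assume j: "j \<in> {1..sF}"
  have "(\<Sum>l=1..s. A_FE n \<Omega> sF AF cF (i, j) l) = (\<Sum>q\<in>{1..s} \<times> {1..sF}. A_FF c AF (i, j) q)"
    using assms(1,3) j by (simp add: internally_consistent_def Let_def)
  also have "\<dots> = (\<Sum>l=1..s. \<Sum>m=1..sF. diag c i l * AF j m)"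
    by (simp add: sum.cartesian_product A_FF_def case_prod_beta)
  also have "\<dots> = (\<Sum>l=1..s. if l = i then c i * rowsum sF AF j else 0)"
    by (intro sum.cong refl) (auto simp: diag_def rowsum_def sum_distrib_left)
  also have "\<dots> = c i * cF j"
    using assms(3) cF j by (simp add: sum.delta)
  finally show "(\<Sum>l=1..s. A_FE n \<Omega> sF AF cF (i, j) l) = c i * cF j" .
qed

theorem theorem2p6:
  fixes s n sF :: nat
    and \<Omega> :: "nat \<Rightarrow> nat \<Rightarrow> nat \<Rightarrow> real"
    and \<Gamma> AF :: "nat \<Rightarrow> nat \<Rightarrow> real"
    and c bF cF :: "nat \<Rightarrow> real"
  assumes "imex_mri_sr s n \<Omega> \<Gamma> c"
    and "\<forall>j\<in>{1..sF}. cF j = rowsum sF AF j"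
    and "internally_consistent s n \<Omega> \<Gamma> c sF AF bF cF"
    and "slow_base_accurate 4 s n \<Omega> \<Gamma>"
    and "rk_accurate (max 4 (n + 2)) sF AF bF cF"
    and "dot s (unitvec s) (mv s (M_mat n \<Omega>) c) = 1 / 6"
    and "dot s (unitvec s)
           (mv s (lincomb n (\<lambda>k. 1 / ((real k + 1) * (real k + 3))) \<Omega>) c) = 1 / 8"
    and "dot s (unitvec s) (mv s (M_mat n \<Omega>) (mv s (diag c) c)) = 1 / 12"
    and "dot s (unitvec s) (mv s \<Gamma> (mv s (diag c) (mv s (M_mat n \<Omega>) c))) = 0"
    and "dot s (unitvec s)
           (mv s (Omega_bar n \<Omega>) (mv s (diag c) (mv s (M_mat n \<Omega>) c))) = 1 / 24"
    and "dot s (unitvec s) (mv s (M_mat n \<Omega>) (mv s (Omega_bar n \<Omega>) c)) = 1 / 24"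
    and "dot s (unitvec s) (mv s (M_mat n \<Omega>) (mv s \<Gamma> c)) = 0"
  shows "mri_accurate 4 s n \<Omega> \<Gamma> c sF AF bF cF"
proof -
  define R where "R = mri_stages s sF"
  define A where "A = mri_coeff n \<Omega> \<Gamma> c sF AF bF cF"
  define cc where "cc = mri_abscissa c cF"
  define tab where "tab = slow_tableau n \<Omega> \<Gamma>"
  define L where "L = lincomb n (\<lambda>k. 1 / ((real k + 1) * (real k + 3))) \<Omega>"
  define N where "N = lincomb n (\<lambda>k. 1 / ((real k + 1) * (real k + 2) * (real k + 3))) \<Omega>"
  define D where "D = stage_defect R A cc"
  let ?M = "M_mat n \<Omega>"
  have "1 \<le> s" and c_1: "c 1 = 0"
    using assms(1) by (auto simp: imex_mri_sr_def)
  then have s: "s \<in> {1..s}"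
    by simp
  note rows = internally_consistent_rows[OF assms(3,2)]
  note slow = slow_order_conditions[OF assms(4) rows(1,2), folded tab_def]
  note fast = rk_order_conditions[OF assms(5)]
  note coeff_sum = mri_coeff_sum[where c = c and s = s and sF = sF, OF _ c_1, folded R_def]
  note hyps = assms(6-12)[unfolded dot_unitvec[OF \<open>1 \<le> s\<close>], folded L_def]

  have slow_c: "(\<Sum>j=1..s. tab \<sigma> s j * c j ^ k) = 1 / (real k + 1)" if "\<sigma> \<noteq> Fast" "k < 4" for \<sigma> k
    by (rule slow(1)[where \<nu> = \<sigma> and \<mu> = \<sigma>]) (use that in auto)
  have slow_A: "(\<Sum>j=1..s. tab \<sigma> s j * (c j ^ l * (\<Sum>q=1..s. tab \<nu> j q * c q ^ k))) =
      1 / ((real k + 1) * (real k + real l + 2))" if "\<sigma> \<noteq> Fast" "\<nu> \<noteq> Fast" "k + l < 3" for \<sigma> \<nu> k l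
    by (rule slow(2)[where \<mu> = \<sigma>]) (use that in auto)
  have slow_AA: "(\<Sum>j=1..s. tab \<sigma> s j * (\<Sum>q=1..s. tab \<nu> j q * (\<Sum>r=1..s. tab \<mu> q r * c r))) = 1 / 24"
    if "\<sigma> \<noteq> Fast" "\<nu> \<noteq> Fast" "\<mu> \<noteq> Fast" for \<sigma> \<nu> \<mu>
    using slow(3)[where \<sigma> = \<sigma> and \<nu> = \<nu> and \<mu> = \<mu> and k = 1] that by simp
  \<comment> \<open>The first-order condition of the slow base method is the row sum of its last
    stage.\<close>
  have c_s: "c s = 1"
    using slow_c[of Expl 0] rows(1)[OF s] by (simp add: tab_def slow_tableau_def rowsum_def)
  have A_slow: "(\<Sum>q\<in>R. A \<sigma> (Slow i) q * w q) = (if \<sigma> = Fast then c i * (\<Sum>m=1..sF. bF m * w (FastSt i m))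
      else \<Sum>l=1..s. tab \<sigma> i l * w (Slow l))" if "i \<in> {1..s}" for \<sigma> i w
    unfolding A_def tab_def by (rule coeff_sum(1)[OF that])
  have A_slow_sum: "(\<Sum>i=1..s. B i * (\<Sum>q\<in>R. A \<sigma> (Slow i) q * w q)) =
      (\<Sum>i=1..s. B i * (if \<sigma> = Fast then c i * (\<Sum>m=1..sF. bF m * w (FastSt i m))
        else \<Sum>l=1..s. tab \<sigma> i l * w (Slow l)))" for B \<sigma> w
    by (intro sum.cong refl) (simp only: A_slow)
  have A_fast: "(\<Sum>q\<in>R. A \<sigma> (FastSt i j) q * w q) = (if \<sigma> = Fast then c i * (\<Sum>m=1..sF. AF j m * w (FastSt i m))
      else \<Sum>l=1..s. A_FE n \<Omega> sF AF cF (i, j) l * w (Slow l))" if "i \<in> {1..s}" for \<sigma> i j w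
    unfolding A_def by (rule coeff_sum(2)[OF that])
  have cc: "cc (Slow i) = c i" "cc (FastSt i j) = c i * cF j" for i j
    by (simp_all add: cc_def)

  \<comment> \<open>The ranges are disjunctions because small \<open>k\<close> come from the stage
    defects, and \<open>k < n\<close> from the powers in the forcing.\<close>
  have fast_1: "(\<Sum>m=1..sF. bF m * cF m ^ k) = 1 / (real k + 1)" if "k < 4 \<or> k < n" for k
    using that by (intro fast(1)) auto
  have fast_A: "(\<Sum>m=1..sF. bF m * (\<Sum>q=1..sF. AF m q * cF q ^ k)) = 1 / ((real k + 1) * (real k + 2))"
    if "k < 3 \<or> k < n" for k
    using fast(2)[of k 0] that by auto
  have fast_cA: "(\<Sum>m=1..sF. bF m * cF m * (\<Sum>q=1..sF. AF m q * cF q ^ k)) = 1 / ((real k + 1) * (real k + 3))"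
    if "k < 2 \<or> k < n" for k
    using fast(2)[of k 1] that by (auto simp: mult.assoc)
  have fast_A': "(\<Sum>m=1..sF. (\<Sum>q=1..sF. bF q * AF q m) * x m) = (\<Sum>q=1..sF. bF q * (\<Sum>m=1..sF. AF q m * x m))" for x
    unfolding sum_distrib_left sum_distrib_right by (subst sum.swap) (simp add: mult_ac)
  have fast_AA: "(\<Sum>m=1..sF. (\<Sum>q=1..sF. bF q * AF q m) * (\<Sum>q=1..sF. AF m q * cF q ^ k)) =
      1 / ((real k + 1) * (real k + 2) * (real k + 3))" if "k < 2 \<or> k < n" for k
    using fast(3)[of k] that unfolding fast_A' by auto

  \<comment> \<open>The fast quadrature integrates these powers exactly up to each slow abscissa, so
    the fast part has defects only at the fast stages.\<close>
  have D_slow_Fast: "D k Fast (Slow i) = 0" if "i \<in> {1..s}" "k < 4" for k i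
  proof -
    have "(\<Sum>m=1..sF. bF m * (c i * cF m) ^ k) = c i ^ k * (\<Sum>m=1..sF. bF m * cF m ^ k)"
      by (simp add: power_mult_distrib sum_distrib_left mult_ac)
    also have "\<dots> = c i ^ k / (real k + 1)"
      using fast_1[of k] that(2) by simp
    finally show ?thesis
      by (simp add: D_def stage_defect_def A_slow[OF that(1)] cc add.commute)
  qed
  have D_slow: "D k \<nu> (Slow i) = (\<Sum>l=1..s. tab \<nu> i l * c l ^ k) - c i ^ Suc k / real (Suc k)"
    if "i \<in> {1..s}" "\<nu> \<noteq> Fast" for k \<nu> i
    using that by (simp add: D_def stage_defect_def A_slow cc)
  \<comment> \<open>For the fast part the defect is that of the fast method scaled by
    \<open>c i ^ Suc k\<close>; for the slow parts the block collapses under the weights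
    \<open>u\<close>.\<close>
  have D_fast_sum: "(\<Sum>m=1..sF. u m * D k \<nu> (FastSt i m)) =
      (if \<nu> = Fast then c i ^ Suc k * (\<Sum>m=1..sF. u m * (\<Sum>q=1..sF. AF m q * cF q ^ k))
       else mv s (lincomb n \<gamma> \<Omega>) (\<lambda>l. c l ^ k) i)
      - c i ^ Suc k / real (Suc k) * (\<Sum>m=1..sF. u m * cF m ^ Suc k)"
    if "i \<in> {1..s}" "\<And>k. k < n \<Longrightarrow> (\<Sum>m=1..sF. u m * (\<Sum>q=1..sF. AF m q * cF q ^ k)) = \<gamma> k"
    for u k \<nu> i \<gamma>
  proof (cases "\<nu> = Fast")
    case True
    then have "D k \<nu> (FastSt i m) = c i ^ Suc k * (\<Sum>q=1..sF. AF m q * cF q ^ k)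
        - c i ^ Suc k / real (Suc k) * cF m ^ Suc k" for m
      by (simp add: D_def stage_defect_def A_fast[OF that(1)] cc del: of_nat_Suc)
        (simp add: power_mult_distrib sum_distrib_left mult_ac del: of_nat_Suc)
    then show ?thesis
      using True by (simp add: right_diff_distrib sum_subtractf sum_distrib_left mult_ac del: of_nat_Suc power_Suc)
  next
    case False
    then have "D k \<nu> (FastSt i m) = (\<Sum>l=1..s. A_FE n \<Omega> sF AF cF (i, m) l * c l ^ k)
        - c i ^ Suc k / real (Suc k) * cF m ^ Suc k" for m
      by (simp add: D_def stage_defect_def A_fast[OF that(1)] cc power_mult_distrib del: of_nat_Suc)
    then have "(\<Sum>m=1..sF. u m * D k \<nu> (FastSt i m)) =
        (\<Sum>m=1..sF. u m * (\<Sum>l=1..s. A_FE n \<Omega> sF AF cF (i, m) l * c l ^ k))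
        - c i ^ Suc k / real (Suc k) * (\<Sum>m=1..sF. u m * cF m ^ Suc k)"
      by (simp add: right_diff_distrib sum_subtractf sum_distrib_left sum_divide_distrib mult_ac
          del: of_nat_Suc power_Suc)
    then show ?thesis
      using False sum_A_FE[OF that(2)] by simp
  qed
  have M_lincomb: "lincomb n (\<lambda>k. 1 / ((real k + 1) * (real k + 2))) \<Omega> = ?M"
    by (simp add: M_mat_def)

  \<comment> \<open>In this and the next three sums the fast part cancels by the conditions of the
    fast method. The denominators are 6 = 2 * 3, 8 = 2 * 4, 12 = 3 * 4 and 24 = 2 * 12, the first
    factor from the defect and the second from the fast quadrature, with b^T A c^2 = 1/12 in the
    last case.\<close>
  have W1: "(\<Sum>m=1..sF. bF m * D 1 \<nu> (FastSt i m)) = (if \<nu> = Fast then 0 else mv s ?M c i - c i ^ 2 / 6)"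
    if "i \<in> {1..s}" for \<nu> i
    using D_fast_sum[OF that fast_A, of 1 \<nu>] fast_A[of 1] fast_1[of 2]
    by (simp add: M_lincomb power2_eq_square)
  have W1c: "(\<Sum>m=1..sF. (bF m * cF m) * D 1 \<nu> (FastSt i m)) = (if \<nu> = Fast then 0 else mv s L c i - c i ^ 2 / 8)"
    if "i \<in> {1..s}" for \<nu> i
    using D_fast_sum[OF that fast_cA, of 1 \<nu>] fast_cA[of 1] fast_1[of 3]
    by (simp add: L_def power2_eq_square power3_eq_cube mult_ac)
  have W2: "(\<Sum>m=1..sF. bF m * D 2 \<nu> (FastSt i m)) =
      (if \<nu> = Fast then 0 else mv s ?M (\<lambda>l. c l ^ 2) i - c i ^ 3 / 12)" if "i \<in> {1..s}" for \<nu> i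
    using D_fast_sum[OF that fast_A, of 2 \<nu>] fast_A[of 2] fast_1[of 3]
    by (simp add: M_lincomb power2_eq_square power3_eq_cube)
  have WA: "(\<Sum>m=1..sF. bF m * (\<Sum>q=1..sF. AF m q * D 1 \<mu> (FastSt i q))) =
      (if \<mu> = Fast then 0 else mv s N c i - c i ^ 2 / 24)" if "i \<in> {1..s}" for \<mu> i
    using D_fast_sum[OF that fast_AA, of 1 \<mu>] fast_AA[of 1] fast_A[of 2]
    unfolding fast_A' by (simp add: N_def power2_eq_square)

  \<comment> \<open>The coupling hypotheses as scalar identities\<close>
  have diag: "mv s (diag c) x l = c l * x l" if "l \<in> {1..s}" for x l
  proof -
    have "mv s (diag c) x l = (\<Sum>j=1..s. if j = l then c l * x l else 0)"
      unfolding mv_def diag_def by (intro sum.cong) auto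
    then show ?thesis
      using that by (simp add: sum.delta)
  qed
  have mv_cong: "mv s B x i = mv s B x' i" if "\<And>l. l \<in> {1..s} \<Longrightarrow> x l = x' l" for B x x' i
    unfolding mv_def using that by (intro sum.cong) auto
  have M_c: "mv s ?M c s = 1 / 6" and L_c: "mv s L c s = 1 / 8"
    using hyps(1,2) .
  have M_cc: "mv s ?M (\<lambda>l. c l ^ 2) s = 1 / 12"
    using hyps(3) mv_cong[of "mv s (diag c) c" "\<lambda>l. c l ^ 2" ?M s] by (simp add: diag power2_eq_square)
  have N_c: "mv s N c s = 1 / 24"
  proof -
    have "1 / ((real k + 1) * (real k + 2) * (real k + 3)) =
        1 / ((real k + 1) * (real k + 2)) - 1 / ((real k + 1) * (real k + 3))" for k
    proof -
      have "real k + 1 \<noteq> 0" "real k + 2 \<noteq> 0" "real k + 3 \<noteq> 0"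
        using of_nat_0_le_iff[of k, where 'a = real] by linarith+
      then show ?thesis
        by (simp add: divide_simps)
    qed
    then have "N i l = ?M i l - L i l" for i l
      by (simp add: N_def L_def M_mat_def lincomb_def left_diff_distrib sum_subtractf)
    then show ?thesis
      using M_c L_c by (simp add: mv_def left_diff_distrib sum_subtractf)
  qed
  \<comment> \<open>The hypothesis for \<open>\<Gamma>\<close> contributes 0, so both slow tableaux
    share the value 1/24; likewise in the next identity.\<close>
  have tab_cMc: "(\<Sum>l=1..s. tab \<sigma> s l * (c l * mv s ?M c l)) = 1 / 24" if "\<sigma> \<noteq> Fast" for \<sigma>
    using hyps(4,5) by (simp add: mv_def[of s \<Gamma>] mv_def[of s "Omega_bar n \<Omega>"] diag tab_def slow_tableau_def
        madd_def distrib_right sum.distrib)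
  have M_tab: "mv s ?M (\<lambda>l. \<Sum>q=1..s. tab \<mu> l q * c q) s = 1 / 24" if "\<mu> \<noteq> Fast" for \<mu>
    using hyps(6,7) by (simp add: mv_def tab_def slow_tableau_def madd_def distrib_right distrib_left sum.distrib)

  \<comment> \<open>Defect conditions for each pattern of slow and fast parts\<close>
  have slow_D: "(\<Sum>l=1..s. B l * D k \<nu> (Slow l)) = (if \<nu> = Fast then 0 else
      (\<Sum>l=1..s. B l * (\<Sum>q=1..s. tab \<nu> l q * c q ^ k)) - (\<Sum>l=1..s. B l * c l ^ Suc k) / real (Suc k))"
    if "k < 4" for B k \<nu>
    using that D_slow_Fast D_slow
    by (simp add: right_diff_distrib sum_subtractf sum_divide_distrib del: of_nat_Suc power_Suc)
  have slow_1: "(\<Sum>l=1..s. tab \<sigma> s l * D 1 \<nu> (Slow l)) = 0" if "\<sigma> \<noteq> Fast" for \<sigma> \<nu>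
    using slow_c[OF that, of 2] slow_A[OF that, of \<nu> 1 0] by (cases "\<nu> = Fast") (simp_all add: slow_D power2_eq_square del: One_nat_def)
  have slow_c1: "(\<Sum>l=1..s. (tab \<sigma> s l * c l) * D 1 \<nu> (Slow l)) = 0" if "\<sigma> \<noteq> Fast" for \<sigma> \<nu>
  proof -
    have "(1 :: nat) < 4"
      by simp
    from slow_c[OF that, of 3] slow_A[OF that, of \<nu> 1 1] show ?thesis
      unfolding slow_D[OF \<open>1 < 4\<close>]
      by (cases "\<nu> = Fast") (simp_all add: power2_eq_square power3_eq_cube mult.assoc del: One_nat_def)
  qed
  have slow_2: "(\<Sum>l=1..s. tab \<sigma> s l * D 2 \<nu> (Slow l)) = 0" if "\<sigma> \<noteq> Fast" for \<sigma> \<nu>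
    using slow_c[OF that, of 3] slow_A[OF that, of \<nu> 2 0] by (cases "\<nu> = Fast") (simp_all add: slow_D power2_eq_square power3_eq_cube del: One_nat_def)
  have slow_A1: "(\<Sum>l=1..s. tab \<sigma> s l * (\<Sum>q=1..s. tab \<nu> l q * D 1 \<mu> (Slow q))) = 0"
    if "\<sigma> \<noteq> Fast" "\<nu> \<noteq> Fast" for \<sigma> \<nu> \<mu>
    using slow_AA[OF that, of \<mu>] slow_A[OF that, of 2 0]
    by (cases "\<mu> = Fast") (simp_all add: slow_D right_diff_distrib sum_subtractf power2_eq_square sum_divide_distrib[symmetric] del: One_nat_def)
  \<comment> \<open>A slow evaluation followed by a fast one: the coupling hypothesis gives 1/24,
    which meets the quadrature term 1/4 divided by 6.\<close>
  have slow_FE: "(\<Sum>l=1..s. tab \<sigma> s l * (c l * (\<Sum>m=1..sF. bF m * D 1 \<mu> (FastSt l m)))) = 0"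
    if "\<sigma> \<noteq> Fast" for \<sigma> \<mu>
  proof (cases "\<mu> = Fast")
    case False
    then have "(\<Sum>l=1..s. tab \<sigma> s l * (c l * (\<Sum>m=1..sF. bF m * D 1 \<mu> (FastSt l m)))) =
        (\<Sum>l=1..s. tab \<sigma> s l * (c l * mv s ?M c l)) - (\<Sum>l=1..s. tab \<sigma> s l * c l ^ 3) / 6"
      by (simp add: W1 right_diff_distrib sum_subtractf sum_divide_distrib power2_eq_square power3_eq_cube
          mult.assoc del: One_nat_def)
    then show ?thesis
      using tab_cMc[OF that] slow_c[OF that, of 3] by simp
  qed (simp add: W1 del: One_nat_def)
  \<comment> \<open>For a slow \<open>\<mu>\<close>, the value 1/24 meets half of 1/12; this settles
    a fast evaluation followed by a slow one.\<close>
  have M_D: "mv s ?M (\<lambda>l. D 1 \<mu> (Slow l)) s = 0" for \<mu>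
    using M_tab[of \<mu>] M_cc by (cases "\<mu> = Fast") (simp_all add: mv_def slow_D power2_eq_square del: One_nat_def)
  have fast_FE: "(\<Sum>m=1..sF. bF m * (\<Sum>l=1..s. A_FE n \<Omega> sF AF cF (s, m) l * D 1 \<mu> (Slow l))) = 0" for \<mu>
    using sum_A_FE[OF fast_A] M_D by (simp add: M_lincomb del: One_nat_def)

  \<comment> \<open>The smoothness witness 4 is the degree assumed in
    \<open>additive_order_4\<close>.\<close>
  show ?thesis
    unfolding mri_accurate_def accurate_def
  proof (intro exI[of _ 4] allI impI)
    fix d f t0 T y Y z \<kappa>
    assume smooth: "\<forall>\<sigma>\<in>UNIV. smooth_rhs d 4 (f \<sigma>)" and T: "T > 0"
      and exact: "exact_solution d UNIV f t0 T y"
      and step: "\<forall>\<^sub>F H in at_right 0. mri_step s n \<Omega> \<Gamma> c sF AF bF cF d f t0 (y t0) H (Y H) (z H)"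
      and lim: "\<forall>r\<in>mri_stages s sF. \<forall>\<kappa><d. ((\<lambda>H. Y H r \<kappa>) \<longlongrightarrow> y t0 \<kappa>) (at_right 0)"
      and \<kappa>: "\<kappa> < d"
    have "(\<lambda>H. Y H (Slow s) \<kappa> - y (t0 + H) \<kappa>) \<in> O[at_right 0](\<lambda>H. H ^ 5)"
    proof (rule additive_order_4[where R = R and A = A and c = cc and S = UNIV, folded D_def])
      show "Slow s \<in> R"
        using s by (simp add: R_def mri_stages_def)
      show "cc (Slow s) = 1"
        by (simp add: cc c_s)
      show "(\<Sum>q\<in>R. A \<sigma> r q) = cc r" if "r \<in> R" for \<sigma> r
      proof -
        from that consider (slow) i where "r = Slow i" "i \<in> {1..s}"
          | (fast) i j where "r = FastSt i j" "i \<in> {1..s}" "j \<in> {1..sF}"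
          unfolding R_def mri_stages_def by fastforce
        then show ?thesis
        proof cases
          case slow
          then show ?thesis
            using A_slow[OF slow(2), of \<sigma> "\<lambda>_. 1"] fast_1[of 0] rows(1,2)[OF slow(2)]
            by (auto simp: cc tab_def slow_tableau_def rowsum_def)
        next
          case fast
          then show ?thesis
            using A_fast[OF fast(2), of \<sigma> j "\<lambda>_. 1"] rows(3)[OF fast(2,3)] assms(2)
            by (auto simp: cc rowsum_def)
        qed
      qed
      show "(\<Sum>q\<in>R. A \<sigma> (Slow s) q * cc q ^ k) = 1 / real (Suc k)" if "k < 4" for \<sigma> k
        using slow_c[OF _ that, of \<sigma>] fast_1[of k] that by (simp add: A_slow[OF s] cc c_s add.commute)
      show "(\<Sum>q\<in>R. A \<sigma> (Slow s) q * D 1 \<nu> q) = 0" for \<sigma> \<nu>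
        using slow_1[of \<sigma> \<nu>] W1[OF s, of \<nu>] M_c by (simp add: A_slow[OF s] c_s)
      show "(\<Sum>q\<in>R. A \<sigma> (Slow s) q * (cc q * D 1 \<nu> q)) = 0" for \<sigma> \<nu>
        using slow_c1[of \<sigma> \<nu>] W1c[OF s, of \<nu>] L_c by (simp add: A_slow[OF s] c_s cc mult.assoc)
      show "(\<Sum>q\<in>R. A \<sigma> (Slow s) q * D 2 \<nu> q) = 0" for \<sigma> \<nu>
        using slow_2[of \<sigma> \<nu>] W2[OF s, of \<nu>] M_cc by (simp add: A_slow[OF s] c_s)
      \<comment> \<open>The four cases for \<open>\<sigma>\<close> and \<open>\<nu>\<close>:
        slow-slow is \<open>slow_A1\<close>, slow-fast \<open>slow_FE\<close>, fast-slow
        \<open>fast_FE\<close>, and fast-fast follows from \<open>WA\<close> with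
        \<open>N_c\<close>. When \<open>\<sigma>\<close> is fast only the last subproblem occurs,
        where \<open>c s = 1\<close>.\<close>
      show "(\<Sum>q\<in>R. A \<sigma> (Slow s) q * (\<Sum>p\<in>R. A \<nu> q p * D 1 \<mu> p)) = 0" for \<sigma> \<nu> \<mu>
        using slow_A1[of \<sigma> \<nu> \<mu>] slow_FE[of \<sigma> \<mu>] fast_FE[of \<mu>] WA[OF s, of \<mu>] N_c
        unfolding A_slow[OF s] A_fast[OF s] A_slow_sum
        by (cases "\<sigma> = Fast"; cases "\<nu> = Fast") (simp_all add: c_s)
      show "\<forall>\<^sub>F H in at_right 0. \<forall>r\<in>R. \<forall>\<kappa><d. Y H r \<kappa> = y t0 \<kappa> +
          H * (\<Sum>\<sigma>\<in>UNIV. \<Sum>q\<in>R. A \<sigma> r q * f \<sigma> (t0 + cc q * H) (Y H q) \<kappa>)"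
        using step
        by eventually_elim
          (use mri_step_stages[OF assms(1) fast_1] in \<open>auto simp: R_def A_def cc_def\<close>)
      show "((\<lambda>H. Y H r \<kappa>) \<longlongrightarrow> y t0 \<kappa>) (at_right 0)" if "r \<in> R" "\<kappa> < d" for r \<kappa>
        using lim that by (simp add: R_def)
    qed (use smooth T exact \<kappa> in auto)
    moreover have eq: "\<forall>\<^sub>F H in at_right 0. z H \<kappa> - y (t0 + H) \<kappa> = Y H (Slow s) \<kappa> - y (t0 + H) \<kappa>"
      using step \<kappa> by (auto elim!: eventually_mono simp: mri_step_def Let_def)
    ultimately show "(\<lambda>H. z H \<kappa> - y (t0 + H) \<kappa>) \<in> O[at_right 0](\<lambda>H. H ^ (4 + 1))"
      unfolding landau_o.big.in_cong[OF eq] by simp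
  qed
qed

end
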